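(* Let $A,B$ be two $2n\times 2n$ real positive definite matrices. Then $$d^\uparrow(A+B)-d^\uparrow(A)\prec^w d^\uparrow(B).$$
   Context: Let $J=\begin{bmatrix}O & I_n\\ -I_n & O\end{bmatrix}$ ($2n\times 2n$). A real $2n\times 2n$ matrix $M$ is symplectic if $M^TJM=J$. By Williamson's theorem, for every real symmetric positive definite $2n\times2n$ matrix $A$ there is a symplectic $M$ with $M^TAM=\begin{bmatrix}D&O\\O&D\end{bmatrix}$, $D=\mathrm{diag}(d_1(A),\dots,d_n(A))$, where $0<d_1(A)\le\dots\le d_n(A)$ are uniquely determined by $A$; they are the symplectic eigenvalues of $A$. Write $d^\uparrow(A)=(d_1(A),\dots,d_n(A))$. For $x\in\mathbb{R}^n$ let $x^\uparrow=(x_1^\uparrow,\dots,x_n^\uparrow)$ be the rearrangement of the components of $x$ in increasing order. For $x,y\in\mathbb{R}^n$, $x\prec^w y$ ($x$ is supermajorised by $y$) means $\sum_{j=1}^k x_j^\uparrow\ge\sum_{j=1}^k y_j^\uparrow$ for all $1\le k\le n$. *)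

theory Defs
  imports Complex_Main "Jordan_Normal_Form.Matrix"
begin

definition J_mat :: "nat \<Rightarrow> real mat" where
  "J_mat n = four_block_mat (0\<^sub>m n n) (1\<^sub>m n) (- 1\<^sub>m n) (0\<^sub>m n n)"

definition symplectic :: "nat \<Rightarrow> real mat \<Rightarrow> bool" where
  "symplectic n M \<longleftrightarrow> M \<in> carrier_mat (2 * n) (2 * n) \<and> transpose_mat M * J_mat n * M = J_mat n"

text \<open>As usual for real matrices in this setting, positive definiteness includes symmetry.\<close>

definition positive_definite :: "nat \<Rightarrow> real mat \<Rightarrow> bool" where
  "positive_definite m A \<longleftrightarrow> A \<in> carrier_mat m m \<and> transpose_mat A = A \<and>
     (\<forall>v \<in> carrier_vec m. v \<noteq> 0\<^sub>v m \<longrightarrow> v \<bullet> (A *\<^sub>v v) > 0)"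

definition williamson_form :: "nat \<Rightarrow> real mat \<Rightarrow> real vec \<Rightarrow> bool" where
  "williamson_form n A d \<longleftrightarrow>
     d \<in> carrier_vec n \<and> (\<forall>i<n. 0 < d $ i) \<and> (\<forall>i j. i \<le> j \<longrightarrow> j < n \<longrightarrow> d $ i \<le> d $ j) \<and>
     (\<exists>M. symplectic n M \<and>
        transpose_mat M * A * M =
          four_block_mat (mat_diag n (($) d)) (0\<^sub>m n n) (0\<^sub>m n n) (mat_diag n (($) d)))"

text \<open>The vector of symplectic eigenvalues of a positive definite \<open>A\<close> of size \<open>2n\<close>, in increasing
  order and indexed from \<open>0\<close>. Existence and uniqueness are Williamson's theorem; for other
  matrices the value is unspecified.\<close>

definition symplectic_eigenvalues :: "nat \<Rightarrow> real mat \<Rightarrow> real vec" where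
  "symplectic_eigenvalues n A = (THE d. williamson_form n A d)"

definition increasing_rearrangement :: "real vec \<Rightarrow> real vec" where
  "increasing_rearrangement x = vec_of_list (sort (list_of_vec x))"

text \<open>\<open>supermajorised n x y\<close> is \<open>x \<prec>\<^sup>w y\<close> in dimension \<open>n\<close>; the sum of the \<open>k\<close> smallest components
  runs over the indices \<open>0, \<dots>, k - 1\<close>.\<close>

definition supermajorised :: "nat \<Rightarrow> real vec \<Rightarrow> real vec \<Rightarrow> bool" where
  "supermajorised n x y \<longleftrightarrow> x \<in> carrier_vec n \<and> y \<in> carrier_vec n \<and>
     (\<forall>k \<in> {1..n}. (\<Sum>j<k. increasing_rearrangement x $ j) \<ge> (\<Sum>j<k. increasing_rearrangement y $ j))"

end

(* Over the complex numbers, iJ is Hermitian, and a Williamson basis of A becomes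
   a complex basis diagonalising A to diag(D, D) and iJ to diag(I, -I). A dimension count then
   gives the interlacing d_j(A) <= lambda_j(X* A X) for every frame X of n columns with
   X* (iJ) X = I; it also yields the uniqueness of the symplectic eigenvalues. Taking for X the
   eigenvectors of A + B on which iJ is positive, X* A X = D(A + B) - X* B X, and the claim is
   reduced to Lidskii's inequality for Hermitian n x n matrices together with the interlacing
   d_j(B) <= lambda_j(X* B X). *)
theory Submission
  imports Defs "Jordan_Normal_Form.Spectral_Radius"
begin

section \<open>Sesquilinear forms on coordinate vectors\<close>

text \<open>J is alternating, so over the reals every vector is null for it; iJ is Hermitian with as
  many positive as negative directions, and its positive vectors take over the role of unit vectors.
  Frames normalised for an indefinite form are unbounded, so dimension counts stand in for minimax
  arguments based on compactness. The interlacing is one-sided: it bounds symplectic eigenvalues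
  from above by eigenvalues of compressions. For A and B this is the direction that the claim wants,
  but A + B enters with the opposite sign, so its compression has to be known exactly. This forces X
  to be the positive eigenframe of A + B itself, on which the trace is the sum of all d_j(A + B).
  Lidskii's inequality is not quoted for Hermitian matrices: a truncation argument proves it
  directly on frames, with the interlacing in place of Weyl's monotonicity.\<close>

definition sesq :: "nat \<Rightarrow> (nat \<Rightarrow> nat \<Rightarrow> complex) \<Rightarrow> (nat \<Rightarrow> complex) \<Rightarrow> (nat \<Rightarrow> complex) \<Rightarrow> complex" where
  "sesq m H x y = (\<Sum>r<m. \<Sum>s<m. cnj (x r) * H r s * y s)"

definition lincomb_fun :: "nat \<Rightarrow> (nat \<Rightarrow> nat \<Rightarrow> complex) \<Rightarrow> (nat \<Rightarrow> complex) \<Rightarrow> nat \<Rightarrow> complex" where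
  "lincomb_fun p w a = (\<lambda>r. \<Sum>j<p. a j * w j r)"

definition diag_fun :: "(nat \<Rightarrow> real) \<Rightarrow> nat \<Rightarrow> nat \<Rightarrow> complex" where
  "diag_fun e i j = (if i = j then complex_of_real (e i) else 0)"

definition hermitian_fun :: "nat \<Rightarrow> (nat \<Rightarrow> nat \<Rightarrow> complex) \<Rightarrow> bool" where
  "hermitian_fun m H \<longleftrightarrow> (\<forall>r<m. \<forall>s<m. H s r = cnj (H r s))"

text \<open>In matrix terms \<open>W* H W = diag e\<close>. The number \<open>p\<close> of columns
  is free, so that one predicate covers full bases and half frames; two forms are diagonalised at
  once by two instances with the same \<open>w\<close>.\<close>

definition gram_eq :: "nat \<Rightarrow> (nat \<Rightarrow> nat \<Rightarrow> complex) \<Rightarrow> nat \<Rightarrow> (nat \<Rightarrow> nat \<Rightarrow> complex) \<Rightarrow> (nat \<Rightarrow> real) \<Rightarrow> bool" where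
  "gram_eq m H p w e \<longleftrightarrow> (\<forall>i<p. \<forall>j<p. sesq m H (w i) (w j) = diag_fun e i j)"

lemma sesq_cong:
  assumes "\<And>r s. r < m \<Longrightarrow> s < m \<Longrightarrow> H r s = H' r s"
    and "\<And>r. r < m \<Longrightarrow> x r = x' r" and "\<And>r. r < m \<Longrightarrow> y r = y' r"
  shows "sesq m H x y = sesq m H' x' y'"
  unfolding sesq_def using assms by (intro sum.cong) auto

lemma sesq_lincomb_left:
  "sesq m H (lincomb_fun p w a) y = (\<Sum>i<p. cnj (a i) * sesq m H (w i) y)"
proof -
  have "sesq m H (lincomb_fun p w a) y = (\<Sum>r<m. \<Sum>s<m. \<Sum>i<p. cnj (a i) * (cnj (w i r) * H r s * y s))"
    unfolding sesq_def lincomb_fun_def by (simp add: sum_distrib_right mult.assoc)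
  also have "\<dots> = (\<Sum>r<m. \<Sum>i<p. \<Sum>s<m. cnj (a i) * (cnj (w i r) * H r s * y s))"
    by (intro sum.cong refl sum.swap)
  also have "\<dots> = (\<Sum>i<p. \<Sum>r<m. \<Sum>s<m. cnj (a i) * (cnj (w i r) * H r s * y s))"
    by (rule sum.swap)
  finally show ?thesis unfolding sesq_def by (simp add: sum_distrib_left)
qed

lemma sesq_lincomb_right:
  "sesq m H x (lincomb_fun p w b) = (\<Sum>j<p. b j * sesq m H x (w j))"
proof -
  have "sesq m H x (lincomb_fun p w b) = (\<Sum>r<m. \<Sum>s<m. \<Sum>j<p. b j * (cnj (x r) * H r s * w j s))"
    unfolding sesq_def lincomb_fun_def by (simp add: sum_distrib_left mult_ac)
  also have "\<dots> = (\<Sum>r<m. \<Sum>j<p. \<Sum>s<m. b j * (cnj (x r) * H r s * w j s))"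
    by (intro sum.cong refl sum.swap)
  also have "\<dots> = (\<Sum>j<p. \<Sum>r<m. \<Sum>s<m. b j * (cnj (x r) * H r s * w j s))"
    by (rule sum.swap)
  finally show ?thesis unfolding sesq_def by (simp add: sum_distrib_left)
qed

text \<open>On coefficient vectors the form becomes the compression \<open>W* H W\<close>; changes
  of frame reduce to this identity.\<close>

lemma sesq_lincomb:
  "sesq m H (lincomb_fun p w a) (lincomb_fun p w b) = sesq p (\<lambda>i j. sesq m H (w i) (w j)) a b"
proof -
  have "sesq m H (lincomb_fun p w a) (lincomb_fun p w b)
      = (\<Sum>i<p. cnj (a i) * (\<Sum>j<p. b j * sesq m H (w i) (w j)))"
    unfolding sesq_lincomb_left by (simp only: sesq_lincomb_right)
  also have "\<dots> = sesq p (\<lambda>i j. sesq m H (w i) (w j)) a b"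
    unfolding sesq_def[of p] sum_distrib_left by (intro sum.cong refl) (simp only: mult_ac)
  finally show ?thesis .
qed

lemma sesq_comb:
  "sesq m H (\<lambda>r. a * x r + b * y r) (\<lambda>r. c * z r + d * t r) =
     cnj a * c * sesq m H x z + cnj a * d * sesq m H x t +
     cnj b * c * sesq m H y z + cnj b * d * sesq m H y t"
proof -
  have "sesq m H (\<lambda>r. a * x r + b * y r) (\<lambda>r. c * z r + d * t r) = (\<Sum>r<m. \<Sum>s<m.
      cnj a * c * (cnj (x r) * H r s * z s) + cnj a * d * (cnj (x r) * H r s * t s) +
      cnj b * c * (cnj (y r) * H r s * z s) + cnj b * d * (cnj (y r) * H r s * t s))"
    unfolding sesq_def by (intro sum.cong refl) (simp add: ring_distribs mult_ac)
  then show ?thesis unfolding sesq_def by (simp only: sum.distrib sum_distrib_left)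
qed

lemma sesq_scale: "sesq m H (\<lambda>r. a * x r) (\<lambda>r. b * y r) = cnj a * b * sesq m H x y"
  unfolding sesq_def by (simp add: sum_distrib_left mult_ac)

lemma sesq_add_form: "sesq m (\<lambda>r s. H r s + K r s) x y = sesq m H x y + sesq m K x y"
  unfolding sesq_def by (simp add: algebra_simps sum.distrib)

lemma sesq_hermitian:
  assumes "hermitian_fun m H"
  shows "sesq m H y x = cnj (sesq m H x y)"
proof -
  have "sesq m H y x = (\<Sum>s<m. \<Sum>r<m. cnj (y r) * H r s * x s)"
    unfolding sesq_def by (rule sum.swap)
  also have "\<dots> = cnj (sesq m H x y)"
    unfolding sesq_def cnj_sum
  proof (intro sum.cong refl)
    fix r s assume "r \<in> {..<m}" "s \<in> {..<m}"
    then have "cnj (H r s) = H s r" using assms unfolding hermitian_fun_def by (metis lessThan_iff)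
    then show "cnj (y s) * H s r * x r = cnj (cnj (x r) * H r s * y s)" by simp
  qed
  finally show ?thesis .
qed

lemma hermitian_fun_gram:
  assumes "hermitian_fun m H"
  shows "hermitian_fun p (\<lambda>i j. sesq m H (w i) (w j))"
  unfolding hermitian_fun_def by (intro allI impI) (rule sesq_hermitian[OF assms])

lemma sesq_diag_fun:
  "sesq p (diag_fun e) a b = (\<Sum>i<p. of_real (e i) * (cnj (a i) * b i))"
proof -
  have "sesq p (diag_fun e) a b = (\<Sum>r<p. \<Sum>s<p. if r = s then of_real (e r) * (cnj (a r) * b r) else 0)"
    unfolding sesq_def diag_fun_def by (intro sum.cong refl) auto
  also have "\<dots> = (\<Sum>i<p. of_real (e i) * (cnj (a i) * b i))"
    by (intro sum.cong refl) simp
  finally show ?thesis .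
qed

lemma Re_sesq_diag_fun:
  "Re (sesq p (diag_fun e) a a) = (\<Sum>i<p. e i * (cmod (a i))\<^sup>2)"
proof -
  have "cnj z * z = of_real ((cmod z)\<^sup>2)" for z
    by (simp add: complex_norm_square mult.commute flip: of_real_power)
  then show ?thesis unfolding sesq_diag_fun by (simp add: Re_sum)
qed

lemma sesq_gram:
  assumes "gram_eq m H p w e"
  shows "sesq m H (lincomb_fun p w a) (lincomb_fun p w b) = sesq p (diag_fun e) a b"
  unfolding sesq_lincomb using assms by (intro sesq_cong) (auto simp: gram_eq_def)

lemma Re_sesq_gram:
  assumes "gram_eq m H p w e"
  shows "Re (sesq m H (lincomb_fun p w a) (lincomb_fun p w a)) = (\<Sum>i<p. e i * (cmod (a i))\<^sup>2)"
  using sesq_gram[OF assms] Re_sesq_diag_fun by simp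

lemma gram_eq_lincomb:
  assumes "\<And>i j. i < p \<Longrightarrow> j < p \<Longrightarrow> sesq m H (w i) (w j) = K i j" and "gram_eq p K q V e"
  shows "gram_eq m H q (\<lambda>i. lincomb_fun p w (V i)) e"
  unfolding gram_eq_def sesq_lincomb
proof (intro allI impI)
  fix i j assume "i < q" "j < q"
  moreover have "sesq p (\<lambda>i j. sesq m H (w i) (w j)) (V i) (V j) = sesq p K (V i) (V j)"
    using assms(1) by (intro sesq_cong) auto
  ultimately show "sesq p (\<lambda>i j. sesq m H (w i) (w j)) (V i) (V j) = diag_fun e i j"
    using assms(2) by (simp add: gram_eq_def)
qed

lemma gram_eq_lincomb_diag:
  assumes "gram_eq m H p w f" and "gram_eq p (diag_fun f) q V e"
  shows "gram_eq m H q (\<lambda>i. lincomb_fun p w (V i)) e"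
  using assms by (intro gram_eq_lincomb) (auto simp: gram_eq_def)

lemma lincomb_fun_assoc:
  "lincomb_fun q (\<lambda>i. lincomb_fun p w (V i)) a = lincomb_fun p w (lincomb_fun q V a)"
proof
  fix r
  have "(\<Sum>j<q. \<Sum>i<p. a j * (V j i * w i r)) = (\<Sum>i<p. \<Sum>j<q. a j * (V j i * w i r))"
    by (rule sum.swap)
  then show "lincomb_fun q (\<lambda>i. lincomb_fun p w (V i)) a r = lincomb_fun p w (lincomb_fun q V a) r"
    by (simp add: lincomb_fun_def sum_distrib_left sum_distrib_right mult.assoc)
qed

section \<open>Dimension counting\<close>

text \<open>Gaussian elimination on the last coordinate. The index type is arbitrary because one
  application is to a disjoint union \<open>S <+> T\<close>.\<close>

lemma nontrivial_relation:
  fixes f :: "'i \<Rightarrow> nat \<Rightarrow> complex"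
  assumes "finite I" and "m < card I"
  shows "\<exists>c. (\<exists>i\<in>I. c i \<noteq> 0) \<and> (\<forall>r<m. (\<Sum>i\<in>I. c i * f i r) = 0)"
  using assms
proof (induction m arbitrary: I f)
  case 0
  then have "I \<noteq> {}" by auto
  then show ?case by (intro exI[of _ "\<lambda>_. 1"]) auto
next
  case (Suc m)
  show ?case
  proof (cases "\<forall>i\<in>I. f i m = 0")
    case True
    from Suc.IH[of I f] Suc.prems obtain c
      where "\<exists>i\<in>I. c i \<noteq> 0" "\<forall>r<m. (\<Sum>i\<in>I. c i * f i r) = 0" by auto
    with True show ?thesis by (intro exI[of _ c]) (auto simp: less_Suc_eq)
  next
    case False
    then obtain p where p: "p \<in> I" "f p m \<noteq> 0" by auto
    \<comment> \<open>Subtracting multiples of the pivot vector \<open>f p\<close> clears coordinate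
      \<open>m\<close>.\<close>
    define g where "g i r = f i r - f i m / f p m * f p r" for i r
    have "m < card (I - {p})" using Suc.prems p by simp
    from Suc.IH[of "I - {p}" g] Suc.prems(1) this obtain c
      where c: "\<exists>i\<in>I-{p}. c i \<noteq> 0" "\<forall>r<m. (\<Sum>i\<in>I-{p}. c i * g i r) = 0" by auto
    \<comment> \<open>The coefficient at \<open>p\<close> collects the subtracted multiples, so that
      both relations have the same value in every coordinate.\<close>
    define c' where "c' = c(p := - (\<Sum>i\<in>I-{p}. c i * f i m) / f p m)"
    have eq: "(\<Sum>i\<in>I. c' i * f i r) = (\<Sum>i\<in>I-{p}. c i * g i r)" for r
    proof -
      have "(\<Sum>i\<in>I. c' i * f i r) = c' p * f p r + (\<Sum>i\<in>I-{p}. c' i * f i r)"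
        using Suc.prems(1) p by (simp add: sum.remove)
      also have "(\<Sum>i\<in>I-{p}. c' i * f i r) = (\<Sum>i\<in>I-{p}. c i * f i r)"
        by (intro sum.cong) (auto simp: c'_def)
      also have "c' p * f p r = - (\<Sum>i\<in>I-{p}. c i * (f i m / f p m * f p r))"
        by (simp add: c'_def sum_distrib_left sum_divide_distrib mult_ac)
      finally show ?thesis by (simp add: g_def right_diff_distrib sum_subtractf)
    qed
    have "g i m = 0" for i using p by (simp add: g_def)
    then have "\<forall>r<Suc m. (\<Sum>i\<in>I. c' i * f i r) = 0"
      using c(2) by (auto simp: eq less_Suc_eq)
    moreover have "\<exists>i\<in>I. c' i \<noteq> 0" using c(1) by (auto simp: c'_def)
    ultimately show ?thesis by blast
  qed
qed

lemma lincomb_fun_support: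
  assumes "S \<subseteq> {..<p}" and "\<And>j. j \<notin> S \<Longrightarrow> a j = 0"
  shows "lincomb_fun p w a r = (\<Sum>j\<in>S. a j * w j r)"
  unfolding lincomb_fun_def using assms by (intro sum.mono_neutral_right) auto

text \<open>Subspaces whose dimensions add up to more than \<open>m\<close> must meet. Independence
  of \<open>P\<close> and \<open>Q\<close> is not assumed, so nontriviality is asserted of the
  coefficients; the common vector may still be zero, and each use has to draw on signs of the
  forms.\<close>

lemma span_intersection:
  assumes S: "S \<subseteq> {..<p}" and T: "T \<subseteq> {..<q}" and card: "m < card S + card T"
  obtains a b where "\<And>j. j \<notin> S \<Longrightarrow> a j = 0" and "\<And>j. j \<notin> T \<Longrightarrow> b j = 0"
    and "\<exists>j. a j \<noteq> 0 \<or> b j \<noteq> 0"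
    and "\<And>r. r < m \<Longrightarrow> lincomb_fun p P a r = lincomb_fun q Q b r"
proof -
  have fin: "finite S" "finite T" using S T by (auto intro: finite_subset)
  define f where "f = case_sum P Q"
  from nontrivial_relation[of "S <+> T" m f] fin card obtain c where
    c: "\<exists>i\<in>S <+> T. c i \<noteq> 0" "\<forall>r<m. (\<Sum>i\<in>S <+> T. c i * f i r) = 0"
    by (auto simp: card_Plus)
  define a where "a j = (if j \<in> S then c (Inl j) else 0)" for j
  define b where "b j = (if j \<in> T then - c (Inr j) else 0)" for j
  show thesis
  proof (rule that[of a b])
    show "\<exists>j. a j \<noteq> 0 \<or> b j \<noteq> 0" using c(1) by (auto simp: a_def b_def)
    fix r assume r: "r < m"
    have "(\<Sum>i\<in>S <+> T. c i * f i r) = (\<Sum>j\<in>S. a j * P j r) - (\<Sum>j\<in>T. b j * Q j r)"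
      using fin by (simp add: sum.Plus f_def a_def b_def sum_negf)
    then show "lincomb_fun p P a r = lincomb_fun q Q b r"
      using c(2) r by (simp add: lincomb_fun_support[OF S] lincomb_fun_support[OF T] a_def b_def)
  qed (auto simp: a_def b_def)
qed

text \<open>For a common vector v of the spans selected by \<open>S\<close> and \<open>T\<close>, y
  G(v) <= A(v) <= x G(v), and G(v) > 0 because G is the identity on \<open>P\<close>. On
  \<open>Q\<close> the form G may be indefinite, so \<open>Ty\<close> is stated without a quotient.
  On the span of \<open>P\<close> only an upper bound for A is asked, which lets \<alpha> come from
  a larger form.\<close>

lemma form_comparison:
  fixes \<alpha> \<beta> \<gamma> :: "nat \<Rightarrow> real"
  assumes S: "S \<subseteq> {..<p}" and T: "T \<subseteq> {..<q}" and card: "m < card S + card T"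
    and PG: "gram_eq m G p P (\<lambda>_. 1)"
    and PA: "\<And>a. Re (sesq m A (lincomb_fun p P a) (lincomb_fun p P a)) \<le> (\<Sum>j<p. \<alpha> j * (cmod (a j))\<^sup>2)"
    and QG: "gram_eq m G q Q \<gamma>" and QA: "gram_eq m A q Q \<beta>"
    and Sx: "\<And>j. j \<in> S \<Longrightarrow> \<alpha> j \<le> x"
    and Ty: "\<And>j. j \<in> T \<Longrightarrow> y * \<gamma> j \<le> \<beta> j" and Tpos: "\<And>j. j \<in> T \<Longrightarrow> 0 < \<beta> j"
  shows "y \<le> x"
proof -
  from span_intersection[OF S T card, of P Q] obtain a b where
    a0: "\<And>j. j \<notin> S \<Longrightarrow> a j = 0" and b0: "\<And>j. j \<notin> T \<Longrightarrow> b j = 0"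
    and nz: "\<exists>j. a j \<noteq> 0 \<or> b j \<noteq> 0"
    and eq: "\<And>r. r < m \<Longrightarrow> lincomb_fun p P a r = lincomb_fun q Q b r" by metis
  let ?v = "lincomb_fun p P a" and ?u = "lincomb_fun q Q b"
  have same: "sesq m H ?v ?v = sesq m H ?u ?u" for H
    using eq by (intro sesq_cong) auto
  have G: "(\<Sum>j<p. (cmod (a j))\<^sup>2) = (\<Sum>j<q. \<gamma> j * (cmod (b j))\<^sup>2)"
    using same[of G] Re_sesq_gram[OF PG, of a] Re_sesq_gram[OF QG, of b] by simp
  have A: "(\<Sum>j<q. \<beta> j * (cmod (b j))\<^sup>2) \<le> (\<Sum>j<p. \<alpha> j * (cmod (a j))\<^sup>2)"
    using same[of A] PA[of a] Re_sesq_gram[OF QA, of b] by simp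
  have "y * (\<Sum>j<p. (cmod (a j))\<^sup>2) \<le> (\<Sum>j<q. \<beta> j * (cmod (b j))\<^sup>2)"
    unfolding G sum_distrib_left
  proof (rule sum_mono)
    fix j
    show "y * (\<gamma> j * (cmod (b j))\<^sup>2) \<le> \<beta> j * (cmod (b j))\<^sup>2"
      using Ty[of j] b0[of j] mult_right_mono[of "y * \<gamma> j" "\<beta> j" "(cmod (b j))\<^sup>2"]
      by (cases "j \<in> T") (auto simp: mult.assoc)
  qed
  also note A
  also have "(\<Sum>j<p. \<alpha> j * (cmod (a j))\<^sup>2) \<le> x * (\<Sum>j<p. (cmod (a j))\<^sup>2)"
    unfolding sum_distrib_left
  proof (rule sum_mono)
    fix j
    show "\<alpha> j * (cmod (a j))\<^sup>2 \<le> x * (cmod (a j))\<^sup>2"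
      using Sx[of j] a0[of j] by (cases "j \<in> S") (auto intro: mult_right_mono)
  qed
  finally have le: "y * (\<Sum>j<p. (cmod (a j))\<^sup>2) \<le> x * (\<Sum>j<p. (cmod (a j))\<^sup>2)" .
  \<comment> \<open>If \<open>a\<close> vanished, A would be at most zero on the common vector, and
    \<open>Tpos\<close> would force \<open>b\<close> to vanish as well.\<close>
  have "0 < (\<Sum>j<p. (cmod (a j))\<^sup>2)"
  proof (rule ccontr)
    assume "\<not> ?thesis"
    moreover have "0 \<le> (\<Sum>j<p. (cmod (a j))\<^sup>2)" by (intro sum_nonneg) auto
    ultimately have "(\<Sum>j<p. (cmod (a j))\<^sup>2) = 0" by linarith
    then have az: "a j = 0" if "j < p" for j using that by (auto simp: sum_nonneg_eq_0_iff)
    then have a_all: "a j = 0" for j using a0[of j] S by (cases "j \<in> S") auto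
    have nonneg: "0 \<le> \<beta> j * (cmod (b j))\<^sup>2" for j
      using Tpos[of j] b0[of j] by (cases "j \<in> T") auto
    have "(\<Sum>j<q. \<beta> j * (cmod (b j))\<^sup>2) \<le> 0" using A a_all by simp
    then have "(\<Sum>j<q. \<beta> j * (cmod (b j))\<^sup>2) = 0"
      using sum_nonneg[of "{..<q}" "\<lambda>j. \<beta> j * (cmod (b j))\<^sup>2"] nonneg by force
    then have "\<beta> j * (cmod (b j))\<^sup>2 = 0" if "j < q" for j
      using that nonneg by (simp add: sum_nonneg_eq_0_iff)
    then have "b j = 0" for j using b0[of j] Tpos[of j] T by (cases "j \<in> T") force+
    with a_all nz show False by simp
  qed
  with le show ?thesis by simp
qed

section \<open>Diagonalisation of Hermitian forms\<close>

definition pos_form :: "nat \<Rightarrow> (nat \<Rightarrow> nat \<Rightarrow> complex) \<Rightarrow> bool" where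
  "pos_form m A \<longleftrightarrow> hermitian_fun m A \<and> (\<forall>x. (\<exists>r<m. x r \<noteq> 0) \<longrightarrow> 0 < Re (sesq m A x x))"

lemma pos_form_id: "pos_form m (diag_fun (\<lambda>_. 1))"
proof -
  have "0 < (\<Sum>i<m. (cmod (x i))\<^sup>2)" if "\<exists>r<m. x r \<noteq> 0" for x :: "nat \<Rightarrow> complex"
    using that by (auto intro: sum_pos2)
  then show ?thesis
    by (simp add: pos_form_def Re_sesq_diag_fun) (simp add: hermitian_fun_def diag_fun_def)
qed

lemma sesq_self_real:
  assumes "hermitian_fun m A"
  shows "sesq m A x x = of_real (Re (sesq m A x x))"
  using arg_cong[OF sesq_hermitian[OF assms, of x x], of Im] by (simp add: complex_eq_iff)

lemma normalise:
  assumes A: "pos_form m A" and x: "\<exists>r<m. x r \<noteq> 0"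
  obtains c where "sesq m A (\<lambda>r. c * x r) (\<lambda>r. c * x r) = 1"
proof -
  define t where "t = Re (sesq m A x x)"
  have t: "0 < t" using A x by (auto simp: pos_form_def t_def)
  have "sesq m A x x = of_real t"
    using sesq_self_real A by (auto simp: pos_form_def t_def)
  then have "sesq m A (\<lambda>r. of_real (1 / sqrt t) * x r) (\<lambda>r. of_real (1 / sqrt t) * x r)
      = of_real (1 / sqrt t * (1 / sqrt t) * t)"
    by (simp only: sesq_scale complex_cnj_complex_of_real of_real_mult)
  also have "1 / sqrt t * (1 / sqrt t) * t = 1" using t by (simp add: field_simps)
  finally show thesis using that[of "of_real (1 / sqrt t)"] by simp
qed

text \<open>Orthogonality to \<open>k < m\<close> vectors is a system of \<open>k\<close> linear
  equations in \<open>m\<close> unknowns, so a further vector always exists. Starting from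
  \<open>k = 0\<close> gives an orthonormal basis of a positive form, starting from
  \<open>k = 1\<close> completes a single eigenvector.\<close>

lemma extend_orthonormal:
  assumes A: "pos_form m A" and w: "gram_eq m A k w (\<lambda>_. 1)" and k: "k \<le> m"
  shows "\<exists>z. gram_eq m A m z (\<lambda>_. 1) \<and> (\<forall>i<k. z i = w i)"
  using w k
proof (induction "m - k" arbitrary: k w)
  case 0
  then show ?case by auto
next
  case (Suc d)
  then have k: "k < m" by simp
  from nontrivial_relation[of "{..<m}" k "\<lambda>s i. \<Sum>r<m. cnj (w i r) * A r s"] k
  obtain c where c: "\<exists>s\<in>{..<m}. c s \<noteq> 0"
    "\<forall>i<k. (\<Sum>s<m. c s * (\<Sum>r<m. cnj (w i r) * A r s)) = 0" by auto
  have orth: "sesq m A (w i) c = 0" if "i < k" for i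
  proof -
    have "sesq m A (w i) c = (\<Sum>s<m. \<Sum>r<m. cnj (w i r) * A r s * c s)"
      unfolding sesq_def by (rule sum.swap)
    also have "\<dots> = (\<Sum>s<m. c s * (\<Sum>r<m. cnj (w i r) * A r s))"
      by (simp add: sum_distrib_left mult_ac)
    finally show ?thesis using c(2) that by simp
  qed
  from normalise[OF A, of c] c(1) obtain t where
    t: "sesq m A (\<lambda>r. t * c r) (\<lambda>r. t * c r) = 1" by auto
  define w' where "w' = w(k := (\<lambda>r. t * c r))"
  have orth': "sesq m A (w i) (\<lambda>r. t * c r) = 0" if "i < k" for i
    using sesq_scale[of m A 1 "w i" t c] orth[OF that] by simp
  then have orth'': "sesq m A (\<lambda>r. t * c r) (w i) = 0" if "i < k" for i
    using sesq_hermitian[of m A "\<lambda>r. t * c r" "w i"] A that by (simp add: pos_form_def)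
  have "gram_eq m A (Suc k) w' (\<lambda>_. 1)"
    using Suc.prems(1) t orth' orth''
    by (auto simp: gram_eq_def w'_def less_Suc_eq diag_fun_def)
  moreover have "d = m - Suc k" "Suc k \<le> m" using Suc.hyps(2) k by auto
  ultimately obtain z where
    z: "gram_eq m A m z (\<lambda>_. 1)" "\<forall>i<Suc k. z i = w' i" using Suc.hyps(1) by blast
  then show ?case by (intro exI[of _ z]) (auto simp: w'_def)
qed

lemma eigenvector_exists:
  fixes K :: "nat \<Rightarrow> nat \<Rightarrow> complex"
  assumes "0 < p"
  obtains v \<mu> where "\<exists>r<p. v r \<noteq> 0" "\<And>r. r < p \<Longrightarrow> (\<Sum>s<p. K r s * v s) = \<mu> * v r"
proof -
  define A where "A = mat p p (\<lambda>(r, s). K r s)"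
  have A: "A \<in> carrier_mat p p" by (simp add: A_def)
  from spectrum_non_empty[OF A] assms obtain \<mu> where "eigenvalue A \<mu>"
    by (auto simp: spectrum_def)
  then obtain u where u: "u \<in> carrier_vec p" "u \<noteq> 0\<^sub>v p" "A *\<^sub>v u = \<mu> \<cdot>\<^sub>v u"
    using A by (auto simp: eigenvalue_def eigenvector_def)
  show thesis
  proof (rule that[of "\<lambda>r. u $ r" \<mu>])
    show "\<exists>r<p. u $ r \<noteq> 0" using u by (metis eq_vecI index_zero_vec carrier_vecD)
    fix r assume r: "r < p"
    have "(A *\<^sub>v u) $ r = (\<Sum>s<p. K r s * u $ s)"
      using r u(1) by (simp add: A_def scalar_prod_def atLeast0LessThan)
    moreover have "(A *\<^sub>v u) $ r = \<mu> * u $ r" unfolding u(3) using u(1) r by simp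
    ultimately show "(\<Sum>s<p. K r s * u $ s) = \<mu> * u $ r" by simp
  qed
qed

text \<open>Deflation: an eigenvector is completed to an orthonormal basis, and the form on the
  remaining basis vectors is Hermitian again.\<close>

lemma hermitian_diagonalisation:
  assumes "hermitian_fun p K"
  shows "\<exists>V e. gram_eq p (diag_fun (\<lambda>_. 1)) p V (\<lambda>_. 1) \<and> gram_eq p K p V e"
  using assms
proof (induction p arbitrary: K)
  case 0
  then show ?case by (auto simp: gram_eq_def)
next
  case (Suc p)
  let ?m = "Suc p" and ?I = "diag_fun (\<lambda>_. 1)"
  obtain v \<mu> where v: "\<exists>r<?m. v r \<noteq> 0" "\<And>r. r < ?m \<Longrightarrow> (\<Sum>s<?m. K r s * v s) = \<mu> * v r"
    by (rule eigenvector_exists[of ?m K]) auto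
  from normalise[OF pos_form_id v(1)] obtain c where
    c: "sesq ?m ?I (\<lambda>r. c * v r) (\<lambda>r. c * v r) = 1" by auto
  define u where "u = (\<lambda>r. c * v r)"
  have "gram_eq ?m ?I 1 (\<lambda>_. u) (\<lambda>_. 1)" using c by (simp add: gram_eq_def u_def diag_fun_def)
  from extend_orthonormal[OF pos_form_id this] obtain z where
    z: "gram_eq ?m ?I ?m z (\<lambda>_. 1)" "z 0 = u" by auto
  \<comment> \<open>Orthogonality to the eigenvector \<open>u\<close> thus implies
    \<open>K\<close>-orthogonality to it, so the two blocks decouple.\<close>
  have eig: "sesq ?m K y u = \<mu> * sesq ?m ?I y u" for y
  proof -
    have "sesq ?m K y u = (\<Sum>r<?m. cnj (y r) * c * (\<Sum>s<?m. K r s * v s))"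
      unfolding sesq_def u_def by (simp only: sum_distrib_left mult_ac)
    also have "\<dots> = (\<Sum>r<?m. \<mu> * (cnj (y r) * u r))"
      using v(2) by (intro sum.cong refl) (simp add: u_def)
    finally show ?thesis by (simp only: sesq_diag_fun sum_distrib_left of_real_1 mult_1)
  qed
  define K' where "K' i j = sesq ?m K (z (Suc i)) (z (Suc j))" for i j
  have "hermitian_fun p K'" unfolding K'_def by (rule hermitian_fun_gram[OF Suc.prems])
  from Suc.IH[OF this] obtain V e where
    V: "gram_eq p ?I p V (\<lambda>_. 1)" "gram_eq p K' p V e" by auto
  define y where "y i = lincomb_fun p (\<lambda>j. z (Suc j)) (V i)" for i
  have yI: "gram_eq ?m ?I p y (\<lambda>_. 1)" unfolding y_def
    using z(1) by (intro gram_eq_lincomb[OF _ V(1)]) (auto simp: gram_eq_def diag_fun_def)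
  have yK: "gram_eq ?m K p y e" unfolding y_def
    by (intro gram_eq_lincomb[OF _ V(2)]) (auto simp: K'_def)
  have y0: "sesq ?m ?I (y i) u = 0" for i
    unfolding y_def sesq_lincomb_left using z by (auto simp: gram_eq_def diag_fun_def intro!: sum.neutral)
  have y0': "sesq ?m ?I u (y i) = 0" for i
    using sesq_hermitian[of ?m ?I u "y i"] y0[of i] pos_form_id by (simp add: pos_form_def)
  have yK0: "sesq ?m K (y i) u = 0" for i using eig y0 by simp
  have yK0': "sesq ?m K u (y i) = 0" for i
    using sesq_hermitian[OF Suc.prems, of u "y i"] yK0 by simp
  have uu: "sesq ?m ?I u u = 1" using c by (simp add: u_def)
  define W where "W i = (case i of 0 \<Rightarrow> u | Suc j \<Rightarrow> y j)" for i
  \<comment> \<open>Taking the real part of the diagonal value as eigenvalue spares a proof that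
    \<mu> is real.\<close>
  define f where "f i = (case i of 0 \<Rightarrow> Re (sesq ?m K u u) | Suc j \<Rightarrow> e j)" for i
  have "gram_eq ?m ?I ?m W (\<lambda>_. 1)"
    unfolding gram_eq_def W_def using yI y0 y0' uu
    by (auto simp: gram_eq_def diag_fun_def split: nat.split)
  moreover have "gram_eq ?m K ?m W f"
    unfolding gram_eq_def W_def f_def using yK yK0 yK0' sesq_self_real[OF Suc.prems, of u]
    by (auto simp: gram_eq_def diag_fun_def split: nat.split)
  ultimately show ?case by blast
qed

lemma sorting_enumeration:
  fixes f :: "nat \<Rightarrow> real"
  assumes "finite S"
  obtains \<sigma> where "bij_betw \<sigma> {..<card S} S"
    and "\<And>i j. i \<le> j \<Longrightarrow> j < card S \<Longrightarrow> f (\<sigma> i) \<le> f (\<sigma> j)"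
proof -
  define xs where "xs = sort_key f (sorted_list_of_set S)"
  have xs: "distinct xs" "set xs = S" "length xs = card S" "sorted (map f xs)"
    using assms by (auto simp: xs_def)
  show thesis
  proof (rule that[of "(!) xs"])
    show "bij_betw ((!) xs) {..<card S} S" using xs by (intro bij_betw_nth) auto
    show "f (xs ! i) \<le> f (xs ! j)" if "i \<le> j" "j < card S" for i j
      using sorted_nth_mono[OF xs(4), of i j] that xs(3) by simp
  qed
qed

lemma gram_eq_reindex:
  assumes "gram_eq m H p w e" and "bij_betw \<sigma> {..<q} S" and "S \<subseteq> {..<p}"
  shows "gram_eq m H q (w \<circ> \<sigma>) (e \<circ> \<sigma>)"
  unfolding gram_eq_def
proof (intro allI impI)
  fix i j assume ij: "i < q" "j < q"
  then have "\<sigma> i < p" "\<sigma> j < p" using assms(2,3) by (auto dest: bij_betwE)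
  moreover have "\<sigma> i = \<sigma> j \<longleftrightarrow> i = j"
    using assms(2) ij by (auto simp: bij_betw_def inj_on_def)
  ultimately show "sesq m H ((w \<circ> \<sigma>) i) ((w \<circ> \<sigma>) j) = diag_fun (e \<circ> \<sigma>) i j"
    using assms(1) by (simp add: gram_eq_def diag_fun_def)
qed

lemma hermitian_diagonalisation_sorted:
  assumes "hermitian_fun p K"
  obtains V e where "gram_eq p (diag_fun (\<lambda>_. 1)) p V (\<lambda>_. 1)" "gram_eq p K p V e"
    "\<And>i j. i \<le> j \<Longrightarrow> j < p \<Longrightarrow> e i \<le> e j"
proof -
  from hermitian_diagonalisation[OF assms] obtain V e where
    V: "gram_eq p (diag_fun (\<lambda>_. 1)) p V (\<lambda>_. 1)" "gram_eq p K p V e" by auto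
  obtain \<sigma> where \<sigma>: "bij_betw \<sigma> {..<p} {..<p}" "\<And>i j. i \<le> j \<Longrightarrow> j < p \<Longrightarrow> e (\<sigma> i) \<le> e (\<sigma> j)"
    using sorting_enumeration[of "{..<p}" e] by auto
  show thesis
    using that[of "V \<circ> \<sigma>" "e \<circ> \<sigma>"] gram_eq_reindex[OF V(1) \<sigma>(1)] gram_eq_reindex[OF V(2) \<sigma>(1)] \<sigma>(2)
    by (simp add: o_def)
qed

lemma trace_orthonormal:
  assumes V: "gram_eq p (diag_fun (\<lambda>_. 1)) p V (\<lambda>_. 1)"
  shows "(\<Sum>j<p. sesq p K (V j) (V j)) = (\<Sum>r<p. K r r)"
proof -
  define U where "U = mat p p (\<lambda>(r, j). V j r)"
  define W where "W = mat p p (\<lambda>(j, r). cnj (V j r))"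
  have UW: "U \<in> carrier_mat p p" "W \<in> carrier_mat p p" by (auto simp: U_def W_def)
  have "W * U = 1\<^sub>m p"
  proof (rule eq_matI)
    fix i j assume "i < dim_row (1\<^sub>m p)" "j < dim_col (1\<^sub>m p)"
    then have ij: "i < p" "j < p" by auto
    then have "(W * U) $$ (i, j) = (\<Sum>r<p. cnj (V i r) * V j r)"
      by (simp add: U_def W_def scalar_prod_def atLeast0LessThan)
    also have "\<dots> = sesq p (diag_fun (\<lambda>_. 1)) (V i) (V j)" by (simp add: sesq_diag_fun)
    finally show "(W * U) $$ (i, j) = 1\<^sub>m p $$ (i, j)"
      using V ij by (simp add: gram_eq_def diag_fun_def)
  qed (use UW in auto)
  \<comment> \<open>A left inverse of a square matrix is also a right inverse: orthonormality of the
    columns becomes completeness.\<close>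
  then have UW1: "U * W = 1\<^sub>m p" using mat_mult_left_right_inverse UW by blast
  have complete: "(\<Sum>j<p. cnj (V j r) * V j s) = (if r = s then 1 else 0)" if "r < p" "s < p" for r s
  proof -
    have "(U * W) $$ (s, r) = (\<Sum>j<p. V j s * cnj (V j r))"
      using that by (simp add: U_def W_def scalar_prod_def atLeast0LessThan)
    then show ?thesis using UW1 that by (auto simp: mult.commute)
  qed
  have "(\<Sum>j<p. sesq p K (V j) (V j)) = (\<Sum>r<p. \<Sum>j<p. \<Sum>s<p. cnj (V j r) * K r s * V j s)"
    unfolding sesq_def by (rule sum.swap)
  also have "\<dots> = (\<Sum>r<p. \<Sum>s<p. \<Sum>j<p. cnj (V j r) * K r s * V j s)"
    by (intro sum.cong refl sum.swap)
  also have "\<dots> = (\<Sum>r<p. \<Sum>s<p. K r s * (\<Sum>j<p. cnj (V j r) * V j s))"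
    by (simp add: sum_distrib_left mult_ac)
  also have "\<dots> = (\<Sum>r<p. \<Sum>s<p. if r = s then K r s else 0)"
    by (intro sum.cong refl) (auto simp: complete)
  also have "\<dots> = (\<Sum>r<p. K r r)" by (intro sum.cong refl) simp
  finally show ?thesis .
qed

section \<open>Williamson's theorem\<close>

definition cform :: "real mat \<Rightarrow> nat \<Rightarrow> nat \<Rightarrow> complex" where
  "cform B = (\<lambda>r s. complex_of_real (B $$ (r, s)))"

definition symp_form :: "nat \<Rightarrow> nat \<Rightarrow> nat \<Rightarrow> complex" where
  "symp_form n = (\<lambda>r s. \<i> * complex_of_real (J_mat n $$ (r, s)))"

text \<open>A Williamson frame is the complex form of a Williamson basis: the vectors
  \<open>(p\<^sub>j \<mp> \<i> q\<^sub>j) / \<surd>2\<close> built from columns \<open>j\<close> and \<open>n + j\<close> of the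
  symplectic \<open>M\<close>, those with the minus sign first.\<close>

definition frame_sign :: "nat \<Rightarrow> nat \<Rightarrow> real" where
  "frame_sign n i = (if i < n then 1 else - 1)"

definition doubled :: "nat \<Rightarrow> (nat \<Rightarrow> real) \<Rightarrow> nat \<Rightarrow> real" where
  "doubled n d i = (if i < n then d i else d (i - n))"

definition williamson_frame :: "nat \<Rightarrow> real mat \<Rightarrow> (nat \<Rightarrow> real) \<Rightarrow> (nat \<Rightarrow> nat \<Rightarrow> complex) \<Rightarrow> bool" where
  "williamson_frame n A d Q \<longleftrightarrow>
     gram_eq (2 * n) (symp_form n) (2 * n) Q (frame_sign n) \<and>
     gram_eq (2 * n) (cform A) (2 * n) Q (doubled n d)"

section \<open>Passage between symplectic matrices and complex frames\<close>

lemma J_mat_index: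
  assumes "r < 2 * n" "s < 2 * n"
  shows "J_mat n $$ (r, s) = (if s = n + r then 1 else if r = n + s then - 1 else 0)"
  using assms unfolding J_mat_def by auto

lemma J_mat_carrier: "J_mat n \<in> carrier_mat (2 * n) (2 * n)"
  unfolding J_mat_def by (auto simp: mult_2)

lemma double_diag_index:
  assumes "r < 2 * n" "s < 2 * n"
  shows "four_block_mat (mat_diag n f) (0\<^sub>m n n) (0\<^sub>m n n) (mat_diag n f) $$ (r, s) =
    (if r = s then doubled n f r else 0)"
  using assms by (auto simp: mat_diag_def doubled_def)

lemma sesq_cform_cols:
  assumes M: "M \<in> carrier_mat m m" and B: "B \<in> carrier_mat m m" and kl: "k < m" "l < m"
  shows "sesq m (cform B) (\<lambda>r. of_real (M $$ (r, k))) (\<lambda>r. of_real (M $$ (r, l))) =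
    of_real ((transpose_mat M * B * M) $$ (k, l))"
proof -
  have "(transpose_mat M * B * M) $$ (k, l) = (\<Sum>r<m. M $$ (r, k) * (\<Sum>s<m. B $$ (r, s) * M $$ (s, l)))"
    using M B kl by (simp add: scalar_prod_def atLeast0LessThan)
  also have "\<dots> = (\<Sum>r<m. \<Sum>s<m. M $$ (r, k) * B $$ (r, s) * M $$ (s, l))"
    by (simp add: sum_distrib_left mult.assoc)
  finally show ?thesis by (simp add: sesq_def cform_def)
qed

lemma sesq_symp_form: "sesq m (symp_form n) x y = \<i> * sesq m (cform (J_mat n)) x y"
  unfolding sesq_def symp_form_def cform_def by (simp add: sum_distrib_left mult_ac)

lemma cnj_sesq_cform:
  "sesq m (cform B) (\<lambda>r. cnj (x r)) y = cnj (sesq m (cform B) x (\<lambda>r. cnj (y r)))"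
  unfolding sesq_def cform_def by simp

lemma cnj_sesq_symp_form:
  "sesq m (symp_form n) (\<lambda>r. cnj (x r)) y = - cnj (sesq m (symp_form n) x (\<lambda>r. cnj (y r)))"
  unfolding sesq_symp_form by (simp add: cnj_sesq_cform)

lemma hermitian_symp_form: "hermitian_fun (2 * n) (symp_form n)"
  unfolding hermitian_fun_def symp_form_def by (auto simp: J_mat_index)

definition half_root :: complex where "half_root = of_real (sqrt (1 / 2))"

lemma half_root_simps: "half_root * half_root = 1 / 2" "cnj half_root = half_root"
proof -
  have "half_root * half_root = of_real (sqrt (1 / 2) * sqrt (1 / 2))"
    unfolding half_root_def by (simp only: of_real_mult)
  also have "sqrt (1 / 2) * sqrt (1 / 2) = (1 / 2 :: real)" by (rule real_sqrt_mult_self[THEN trans]) simp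
  finally show "half_root * half_root = 1 / 2" by simp
qed (simp add: half_root_def)

lemma half_root_mult: "half_root * (half_root * z) = z / 2"
  using half_root_simps(1) by (simp flip: mult.assoc)

lemma sesq_half_root:
  assumes "x = (\<lambda>r. half_root * u r + half_root * a * u' r)"
    and "y = (\<lambda>r. half_root * v r + half_root * b * v' r)"
  shows "sesq m H x y = (sesq m H u v + b * sesq m H u v' + cnj a * sesq m H u' v + cnj a * b * sesq m H u' v') / 2"
  unfolding assms sesq_comb
  by (simp add: half_root_simps half_root_mult mult_ac add_divide_distrib)

lemma frame_of_symplectic:
  assumes M: "symplectic n M" and A: "A \<in> carrier_mat (2 * n) (2 * n)"
    and d: "transpose_mat M * A * M = four_block_mat (mat_diag n f) (0\<^sub>m n n) (0\<^sub>m n n) (mat_diag n f)"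
  shows "\<exists>Q. williamson_frame n A f Q"
proof -
  have Mc: "M \<in> carrier_mat (2 * n) (2 * n)" and MJ: "transpose_mat M * J_mat n * M = J_mat n"
    using M by (auto simp: symplectic_def)
  define x where "x k = (\<lambda>r. complex_of_real (M $$ (r, k)))" for k
  have xA: "sesq (2 * n) (cform A) (x k) (x l) = (if k = l then of_real (doubled n f k) else 0)"
    if "k < 2 * n" "l < 2 * n" for k l
    using sesq_cform_cols[OF Mc A that] that by (simp only: d double_diag_index x_def) simp
  have xJ: "sesq (2 * n) (symp_form n) (x k) (x l) = (if l = n + k then \<i> else if k = n + l then - \<i> else 0)"
    if "k < 2 * n" "l < 2 * n" for k l
    using sesq_cform_cols[OF Mc J_mat_carrier that] that
    by (simp only: MJ J_mat_index x_def sesq_symp_form) simp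
  \<comment> \<open>\<open>k j\<close> numbers the conjugate pair that contains \<open>j\<close>,
    and \<open>c j\<close> is the coefficient that tells its two members apart.\<close>
  define k where "k j = (if j < n then j else j - n)" for j
  define c where "c j = (if j < n then - \<i> else \<i>)" for j
  define Q where "Q j = (\<lambda>r. half_root * x (k j) r + half_root * c j * x (n + k j) r)" for j
  have Q: "sesq (2 * n) H (Q i) (Q j) = (sesq (2 * n) H (x (k i)) (x (k j)) +
      c j * sesq (2 * n) H (x (k i)) (x (n + k j)) + cnj (c i) * sesq (2 * n) H (x (n + k i)) (x (k j)) +
      cnj (c i) * c j * sesq (2 * n) H (x (n + k i)) (x (n + k j))) / 2" for H i j
    by (rule sesq_half_root) (simp_all add: Q_def)
  have kn: "k j < n" "n + k j < 2 * n" "k j < 2 * n" "k i \<noteq> n + k j" if "j < 2 * n" "i < 2 * n" for i j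
    using that by (auto simp: k_def)
  \<comment> \<open>Within one pair the values depend only on \<open>c i\<close> and
    \<open>c j\<close>: equal signs give 1 or -1 for iJ and the eigenvalue for A, opposite signs
    cancel in both.\<close>
  have QJ: "sesq (2 * n) (symp_form n) (Q i) (Q j) = (if k i = k j then \<i> * (c j - cnj (c i)) / 2 else 0)"
    if "i < 2 * n" "j < 2 * n" for i j
    unfolding Q using kn[OF that] kn[OF that(2) that(1)] by (simp add: xJ) (simp add: algebra_simps)
  have QA: "sesq (2 * n) (cform A) (Q i) (Q j) = (if k i = k j then (1 + cnj (c i) * c j) / 2 * f (k i) else 0)"
    if "i < 2 * n" "j < 2 * n" for i j
    unfolding Q using kn[OF that] kn[OF that(2) that(1)] by (simp add: xA doubled_def) (simp add: field_simps)
  have "sesq (2 * n) (symp_form n) (Q i) (Q j) = diag_fun (frame_sign n) i j \<and>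
      sesq (2 * n) (cform A) (Q i) (Q j) = diag_fun (doubled n f) i j"
    if "i < 2 * n" "j < 2 * n" for i j
    unfolding QJ[OF that] QA[OF that] using that
    by (cases "i < n"; cases "j < n") (auto simp: k_def c_def diag_fun_def frame_sign_def doubled_def)
  then have "gram_eq (2 * n) (symp_form n) (2 * n) Q (frame_sign n)"
    "gram_eq (2 * n) (cform A) (2 * n) Q (doubled n f)"
    unfolding gram_eq_def by blast+
  then show ?thesis unfolding williamson_frame_def by blast
qed

text \<open>The columns of a real matrix are built from real and imaginary parts; pairing the frame
  by conjugation puts these parts back into its span, where both forms are known.\<close>

lemma symplectic_of_frame:
  assumes Q: "williamson_frame n A f Q" and A: "A \<in> carrier_mat (2 * n) (2 * n)"
    and cnjQ: "\<And>j. j < n \<Longrightarrow> Q (n + j) = (\<lambda>r. cnj (Q j r))"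
  shows "\<exists>M. symplectic n M \<and>
    transpose_mat M * A * M = four_block_mat (mat_diag n f) (0\<^sub>m n n) (0\<^sub>m n n) (mat_diag n f)"
proof -
  define M where "M = mat (2 * n) (2 * n) (\<lambda>(r, c).
    if c < n then sqrt 2 * Re (Q c r) else - sqrt 2 * Im (Q (c - n) r))"
  have Mc: "M \<in> carrier_mat (2 * n) (2 * n)" by (simp add: M_def)
  define x where "x k = (\<lambda>r. complex_of_real (M $$ (r, k)))" for k
  define k where "k j = (if j < n then j else j - n)" for j
  \<comment> \<open>A vector plus its conjugate, divided by sqrt 2, is the column sqrt 2 Re for the
    factor 1 and the column - sqrt 2 Im for the factor \<i>.\<close>
  define t where "t j = (if j < n then 1 else \<i>)" for j
  define u where "u j = (\<lambda>r. t j * Q (k j) r)" for j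
  define u' where "u' j = (\<lambda>r. cnj (t j) * Q (n + k j) r)" for j
  define y where "y j = (\<lambda>r. half_root * u j r + half_root * 1 * u' j r)" for j
  have kn: "k j < n" if "j < 2 * n" for j using that by (auto simp: k_def)
  have root2: "complex_of_real (sqrt 2) * complex_of_real (sqrt 2) = 2"
    by (simp flip: of_real_mult)
  have half: "half_root = of_real (sqrt 2 / 2)"
    unfolding half_root_def by (simp add: real_sqrt_divide real_div_sqrt field_simps root2)
  have xy: "x j r = y j r" if "j < 2 * n" "r < 2 * n" for j r
    using that cnjQ[OF kn[OF that(1)]]
    by (auto simp: x_def y_def u_def u'_def t_def M_def k_def half complex_eq_iff)
  have sx: "sesq (2 * n) H (x i) (x j) = (sesq (2 * n) H (u i) (u j) + sesq (2 * n) H (u i) (u' j) +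
      sesq (2 * n) H (u' i) (u j) + sesq (2 * n) H (u' i) (u' j)) / 2"
    if "i < 2 * n" "j < 2 * n" for H i j
  proof -
    have "sesq (2 * n) H (x i) (x j) = sesq (2 * n) H (y i) (y j)"
      using that xy by (intro sesq_cong) auto
    then show ?thesis using sesq_half_root[of "y i" "u i" 1 "u' i" "y j" "u j" 1 "u' j"]
      by (simp add: y_def)
  qed
  note QJ = Q[unfolded williamson_frame_def gram_eq_def, THEN conjunct1, rule_format]
  note QA = Q[unfolded williamson_frame_def gram_eq_def, THEN conjunct2, rule_format]
  have J: "(transpose_mat M * J_mat n * M) $$ (i, j) = J_mat n $$ (i, j)" if "i < 2 * n" "j < 2 * n" for i j
  proof -
    have "\<i> * of_real ((transpose_mat M * J_mat n * M) $$ (i, j)) = sesq (2 * n) (symp_form n) (x i) (x j)"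
      using sesq_cform_cols[OF Mc J_mat_carrier that] by (simp add: sesq_symp_form x_def)
    also have "\<dots> = \<i> * of_real (J_mat n $$ (i, j))"
      unfolding sx[OF that] J_mat_index[OF that] u_def u'_def using kn[OF that(1)] kn[OF that(2)] that
      by (auto simp: sesq_scale t_def QJ diag_fun_def frame_sign_def k_def split: if_splits)
    finally show ?thesis by simp
  qed
  have D: "(transpose_mat M * A * M) $$ (i, j) = (if i = j then doubled n f i else 0)" if "i < 2 * n" "j < 2 * n" for i j
  proof -
    have "complex_of_real ((transpose_mat M * A * M) $$ (i, j)) = sesq (2 * n) (cform A) (x i) (x j)"
      using sesq_cform_cols[OF Mc A that] by (simp add: x_def)
    also have "\<dots> = of_real (if i = j then doubled n f i else 0)"
      unfolding sx[OF that] u_def u'_def using kn[OF that(1)] kn[OF that(2)] that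
      by (auto simp: sesq_scale t_def QA diag_fun_def doubled_def k_def split: if_splits)
    finally show ?thesis by simp
  qed
  have "transpose_mat M * J_mat n * M = J_mat n"
    using J Mc J_mat_carrier[of n] by (intro eq_matI) auto
  moreover have "transpose_mat M * A * M = four_block_mat (mat_diag n f) (0\<^sub>m n n) (0\<^sub>m n n) (mat_diag n f)"
    (is "_ = ?D")
  proof (rule eq_matI)
    have dims: "dim_row ?D = 2 * n" "dim_col ?D = 2 * n" by (simp_all add: mat_diag_def)
    show "dim_row (transpose_mat M * A * M) = dim_row ?D" "dim_col (transpose_mat M * A * M) = dim_col ?D"
      using Mc A unfolding dims by auto
    fix i j assume "i < dim_row ?D" "j < dim_col ?D"
    then show "(transpose_mat M * A * M) $$ (i, j) = ?D $$ (i, j)"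
      unfolding dims by (simp only: D double_diag_index)
  qed
  ultimately show ?thesis using Mc by (auto simp: symplectic_def)
qed

section \<open>Existence through the spectrum of iJ relative to A\<close>

lemma positive_definite_pos_form:
  assumes "positive_definite m A"
  shows "pos_form m (cform A)"
proof -
  have A: "A \<in> carrier_mat m m" "transpose_mat A = A"
    and pos: "\<And>v. v \<in> carrier_vec m \<Longrightarrow> v \<noteq> 0\<^sub>v m \<Longrightarrow> 0 < v \<bullet> (A *\<^sub>v v)"
    using assms by (auto simp: positive_definite_def)
  have sym: "A $$ (s, r) = A $$ (r, s)" if "r < m" "s < m" for r s
    using A that by (metis carrier_matD index_transpose_mat(1))
  have quad: "vec m g \<bullet> (A *\<^sub>v vec m g) = (\<Sum>r<m. \<Sum>s<m. A $$ (r, s) * (g r * g s))" for g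
    using A by (simp add: scalar_prod_def atLeast0LessThan sum_distrib_left mult_ac)
  have nonneg: "0 \<le> vec m g \<bullet> (A *\<^sub>v vec m g)" for g
    using pos[of "vec m g"] A by (cases "vec m g = 0\<^sub>v m") auto
  have strict: "0 < vec m g \<bullet> (A *\<^sub>v vec m g)" if "r < m" "g r \<noteq> 0" for g r
  proof (rule pos)
    show "vec m g \<noteq> 0\<^sub>v m" using that by (metis index_vec index_zero_vec(1))
  qed simp
  \<comment> \<open>Mixed products of real and imaginary parts are purely imaginary, so complex
    definiteness reduces to real definiteness at the two parts of \<open>x\<close>.\<close>
  have Re: "Re (sesq m (cform A) x x) = vec m (\<lambda>r. Re (x r)) \<bullet> (A *\<^sub>v vec m (\<lambda>r. Re (x r))) +
      vec m (\<lambda>r. Im (x r)) \<bullet> (A *\<^sub>v vec m (\<lambda>r. Im (x r)))" for x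
    unfolding quad sesq_def cform_def sum.distrib[symmetric] Re_sum
    by (intro sum.cong refl) (simp add: algebra_simps)
  have "0 < Re (sesq m (cform A) x x)" if "r < m" "x r \<noteq> 0" for x r
  proof (cases "Re (x r) = 0")
    case True
    then have "Im (x r) \<noteq> 0" using that by (simp add: complex_eq_iff)
    then show ?thesis using strict[of r "\<lambda>r. Im (x r)"] nonneg[of "\<lambda>r. Re (x r)"] that
      unfolding Re by simp
  next
    case False
    then show ?thesis using strict[of r "\<lambda>r. Re (x r)"] nonneg[of "\<lambda>r. Im (x r)"] that
      unfolding Re by simp
  qed
  moreover have "hermitian_fun m (cform A)"
    unfolding hermitian_fun_def cform_def by (simp add: sym)
  ultimately show ?thesis by (auto simp: pos_form_def)
qed

text \<open>\<open>m + 1\<close> vectors in dimension \<open>m\<close> are dependent, and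
  orthonormality keeps the coefficient of \<open>z\<close> from vanishing.\<close>

lemma orthonormal_expansion:
  assumes w: "gram_eq m A m w (\<lambda>_. 1)"
  obtains a where "\<And>r. r < m \<Longrightarrow> z r = lincomb_fun m w a r"
proof -
  define f where "f i = (if i < m then w i else z)" for i
  from nontrivial_relation[of "{..<Suc m}" m f] obtain c where
    c: "\<exists>i<Suc m. c i \<noteq> 0" "\<And>r. r < m \<Longrightarrow> (\<Sum>i<Suc m. c i * f i r) = 0" by auto
  have split: "lincomb_fun m w c r + c m * z r = 0" if "r < m" for r
    using c(2)[OF that] by (simp add: f_def lincomb_fun_def)
  have "c m \<noteq> 0"
  proof
    assume cm: "c m = 0"
    then have "sesq m A (lincomb_fun m w c) (lincomb_fun m w c) = sesq m A (\<lambda>_. 0) (\<lambda>_. 0)"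
      using split by (intro sesq_cong) auto
    then have "(\<Sum>i<m. (cmod (c i))\<^sup>2) = 0" using Re_sesq_gram[OF w, of c] by (simp add: sesq_def)
    then have "\<forall>i<m. c i = 0" by (simp add: sum_nonneg_eq_0_iff)
    with cm c(1) show False by (auto simp: less_Suc_eq)
  qed
  show thesis
  proof (rule that[of "\<lambda>i. - c i / c m"])
    fix r assume "r < m"
    then have "c m * z r = - lincomb_fun m w c r" using split by (simp add: eq_neg_iff_add_eq_0 add.commute)
    then have "z r = - lincomb_fun m w c r / c m" using \<open>c m \<noteq> 0\<close> by (metis nonzero_mult_div_cancel_left)
    then show "z r = lincomb_fun m w (\<lambda>i. - c i / c m) r"
      by (simp add: lincomb_fun_def sum_negf sum_divide_distrib)
  qed
qed

text \<open>Simultaneous diagonalisation says G w_j = e_j A w_j. The test vector is arbitrary, so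
  that the relation can be used against conjugates of the frame, whose products with the frame are
  not known beforehand.\<close>

lemma pencil_eigenvector:
  assumes w: "gram_eq m A m w (\<lambda>_. 1)" and wG: "gram_eq m G m w e" and j: "j < m"
  shows "sesq m G z (w j) = of_real (e j) * sesq m A z (w j)"
proof -
  obtain a where a: "\<And>r. r < m \<Longrightarrow> z r = lincomb_fun m w a r"
    using orthonormal_expansion[OF w, of z] by blast
  have *: "sesq m H z (w j) = (\<Sum>i<m. cnj (a i) * sesq m H (w i) (w j))" for H
    unfolding sesq_lincomb_left[symmetric] using a by (intro sesq_cong) auto
  have "sesq m A z (w j) = cnj (a j)" "sesq m G z (w j) = cnj (a j) * of_real (e j)"
  proof -
    have "(\<Sum>i<m. cnj (a i) * diag_fun f i j) = (\<Sum>i<m. if i = j then cnj (a j) * of_real (f j) else 0)" for f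
      by (intro sum.cong refl) (auto simp: diag_fun_def)
    then show "sesq m A z (w j) = cnj (a j)" "sesq m G z (w j) = cnj (a j) * of_real (e j)"
      unfolding * using w wG j by (simp_all add: gram_eq_def)
  qed
  then show ?thesis by simp
qed

text \<open>Conjugation preserves a real symmetric form and negates the form \<open>\<i> J\<close>, so the
  eigenvalues of the pencil come in pairs of opposite sign.\<close>

lemma symp_sign_count:
  assumes w: "gram_eq (2 * n) (symp_form n) (2 * n) w e"
  shows "card {j. j < 2 * n \<and> 0 < s * e j} \<le> n"
proof (rule ccontr)
  define S where "S = {j. j < 2 * n \<and> 0 < s * e j}"
  let ?G = "symp_form n" and ?w' = "\<lambda>j r. cnj (w j r)"
  assume "\<not> ?thesis"
  then have card: "2 * n < card S + card S" by (simp add: S_def)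
  have S: "S \<subseteq> {..<2 * n}" by (auto simp: S_def)
  obtain a b where a0: "\<And>j. j \<notin> S \<Longrightarrow> a j = 0" and b0: "\<And>j. j \<notin> S \<Longrightarrow> b j = 0"
    and nz: "\<exists>j. a j \<noteq> 0 \<or> b j \<noteq> 0"
    and eq: "\<And>r. r < 2 * n \<Longrightarrow> lincomb_fun (2 * n) w a r = lincomb_fun (2 * n) ?w' b r"
    using span_intersection[OF S S card, of w ?w'] by metis
  have w': "gram_eq (2 * n) ?G (2 * n) ?w' (\<lambda>j. - e j)"
    using w unfolding gram_eq_def cnj_sesq_symp_form by (simp add: diag_fun_def)
  have "sesq (2 * n) ?G (lincomb_fun (2 * n) w a) (lincomb_fun (2 * n) w a) =
      sesq (2 * n) ?G (lincomb_fun (2 * n) ?w' b) (lincomb_fun (2 * n) ?w' b)"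
    using eq by (intro sesq_cong) auto
  \<comment> \<open>The value is computed in \<open>w\<close> and, with reversed signs, in the
    conjugate basis; brought to one side, all terms over \<open>S\<close> have the sign of
    \<open>s\<close>, hence vanish.\<close>
  then have "(\<Sum>i<2 * n. e i * (cmod (a i))\<^sup>2) + (\<Sum>i<2 * n. e i * (cmod (b i))\<^sup>2) = 0"
    using Re_sesq_gram[OF w, of a] Re_sesq_gram[OF w', of b] by (simp add: sum_negf)
  then have "s * ((\<Sum>i<2 * n. e i * (cmod (a i))\<^sup>2) + (\<Sum>i<2 * n. e i * (cmod (b i))\<^sup>2)) = 0" by simp
  then have "(\<Sum>i<2 * n. s * e i * ((cmod (a i))\<^sup>2 + (cmod (b i))\<^sup>2)) = 0"
    unfolding sum.distrib[symmetric] sum_distrib_left by (simp add: ring_distribs mult.assoc)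
  moreover have "0 \<le> s * e i * ((cmod (a i))\<^sup>2 + (cmod (b i))\<^sup>2)" if "i < 2 * n" for i
    using a0[of i] b0[of i] that by (cases "i \<in> S") (auto simp: S_def)
  ultimately have "\<forall>i<2 * n. s * e i * ((cmod (a i))\<^sup>2 + (cmod (b i))\<^sup>2) = 0"
    by (subst (asm) sum_nonneg_eq_0_iff) auto
  then have "a i = 0 \<and> b i = 0" for i
    using a0[of i] b0[of i] by (cases "i \<in> S") (auto simp: S_def add_nonneg_eq_0_iff)
  with nz show False by blast
qed

lemma symp_form_nondegenerate:
  assumes "\<And>z. sesq (2 * n) (symp_form n) z y = 0" and r: "r < 2 * n"
  shows "y r = 0"
proof -
  \<comment> \<open>\<open>q\<close> is the row of J whose only nonzero entry lies in column
    \<open>r\<close>.\<close>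
  define q where "q = (if r < n then n + r else r - n)"
  have q: "q < 2 * n" using r by (auto simp: q_def)
  have "0 = sesq (2 * n) (symp_form n) (\<lambda>i. if i = q then 1 else 0) y" using assms(1) by simp
  also have "\<dots> = (\<Sum>i<2 * n. if i = q then \<Sum>s<2 * n. symp_form n q s * y s else 0)"
    unfolding sesq_def by (intro sum.cong refl) simp
  also have "\<dots> = (\<Sum>s<2 * n. symp_form n q s * y s)" using q by simp
  also have "\<dots> = (\<Sum>s<2 * n. if s = r then (if r < n then - \<i> else \<i>) * y r else 0)"
    using q r by (intro sum.cong refl) (auto simp: symp_form_def J_mat_index q_def)
  also have "\<dots> = (if r < n then - \<i> else \<i>) * y r" using r by simp
  finally show ?thesis by (auto split: if_splits)
qed

text \<open>Relative to the positive form A, iJ has real nonzero eigenvalues \<open>e\<close>,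
  exactly \<open>n\<close> of them positive. Rescaling a positive eigenvector until iJ has value 1
  on it changes the value of A from 1 to 1 / e, which is therefore the symplectic
  eigenvalue.\<close>

lemma williamson_exists:
  assumes pd: "positive_definite (2 * n) A"
  shows "\<exists>d. williamson_form n A d"
proof -
  let ?m = "2 * n" and ?H = "cform A" and ?G = "symp_form n"
  have A: "A \<in> carrier_mat ?m ?m" using pd by (simp add: positive_definite_def)
  have H: "pos_form ?m ?H" by (rule positive_definite_pos_form[OF pd])
  then have herm: "hermitian_fun ?m ?H" by (simp add: pos_form_def)
  obtain z where z: "gram_eq ?m ?H ?m z (\<lambda>_. 1)"
    using extend_orthonormal[OF H, of 0] by (auto simp: gram_eq_def)
  obtain V e where V: "gram_eq ?m (diag_fun (\<lambda>_. 1)) ?m V (\<lambda>_. 1)"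
    "gram_eq ?m (\<lambda>i j. sesq ?m ?G (z i) (z j)) ?m V e"
    using hermitian_diagonalisation[OF hermitian_fun_gram[OF hermitian_symp_form]] by blast
  define w where "w i = lincomb_fun ?m z (V i)" for i
  have wH: "gram_eq ?m ?H ?m w (\<lambda>_. 1)"
    unfolding w_def by (rule gram_eq_lincomb_diag[OF z V(1)])
  have wG: "gram_eq ?m ?G ?m w e"
    unfolding w_def by (rule gram_eq_lincomb[OF refl V(2)])
  note eig = pencil_eigenvector[OF wH wG]
  have e0: "e j \<noteq> 0" if "j < ?m" for j
  proof
    assume "e j = 0"
    then have "w j r = 0" if "r < ?m" for r
      using symp_form_nondegenerate[of n "w j" r] eig[OF \<open>j < ?m\<close>] that by simp
    then have "sesq ?m ?H (w j) (w j) = sesq ?m ?H (\<lambda>_. 0) (\<lambda>_. 0)" by (intro sesq_cong) auto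
    then show False using wH that by (simp add: gram_eq_def diag_fun_def sesq_def)
  qed
  define S where "S = {j. j < ?m \<and> 0 < e j}"
  define N where "N = {j. j < ?m \<and> e j < 0}"
  have "card S \<le> n" "card N \<le> n"
    using symp_sign_count[OF wG, of 1] symp_sign_count[OF wG, of "- 1"] by (auto simp: S_def N_def)
  moreover have "card (S \<union> N) = card S + card N"
    by (intro card_Un_disjoint) (auto simp: S_def N_def)
  moreover have "S \<union> N = {..<?m}" using e0 by (force simp: S_def N_def)
  \<comment> \<open>At most \<open>n\<close> of either sign and \<open>2 * n\<close> in total leave
    exactly \<open>n\<close> of each.\<close>
  ultimately have cardS: "card S = n" by simp
  obtain \<sigma> where \<sigma>: "bij_betw \<sigma> {..<n} S" and mono: "\<And>i j. i \<le> j \<Longrightarrow> j < n \<Longrightarrow> 1 / e (\<sigma> i) \<le> 1 / e (\<sigma> j)"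
    using sorting_enumeration[of S "\<lambda>j. 1 / e j"] cardS by (auto simp: S_def)
  have \<sigma>S: "\<sigma> j < ?m" "0 < e (\<sigma> j)" if "j < n" for j
    using bij_betwE[OF \<sigma>] that by (auto simp: S_def)
  define d where "d j = 1 / e (\<sigma> j)" for j
  define x where "x j = (\<lambda>r. complex_of_real (sqrt (d j)) * w (\<sigma> j) r)" for j
  \<comment> \<open>The negative half is made of conjugates of the positive half, because the
    eigenvectors found for negative \<open>e\<close> need not be paired by conjugation.\<close>
  define Q where "Q j = (if j < n then x j else (\<lambda>r. cnj (x (j - n) r)))" for j
  have dpos: "0 < d j" if "j < n" for j using \<sigma>S[OF that] by (simp add: d_def)
  have inj: "\<sigma> i = \<sigma> j \<longleftrightarrow> i = j" if "i < n" "j < n" for i j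
    using \<sigma> that by (auto simp: bij_betw_def inj_on_def)
  have root: "complex_of_real (sqrt (d j)) * complex_of_real (sqrt (d j)) = of_real (d j)" if "j < n" for j
    using dpos[OF that] by (simp flip: of_real_mult)
  have xH: "sesq ?m ?H (x i) (x j) = diag_fun d i j" if "i < n" "j < n" for i j
    using wH \<sigma>S(1)[OF that(1)] \<sigma>S(1)[OF that(2)] inj[OF that] root[OF that(1)]
    unfolding x_def sesq_scale by (auto simp: gram_eq_def diag_fun_def)
  have xG: "sesq ?m ?G (x i) (x j) = diag_fun (\<lambda>_. 1) i j" if "i < n" "j < n" for i j
    using wG \<sigma>S[OF that(1)] \<sigma>S[OF that(2)] inj[OF that] root[OF that(1)]
    unfolding x_def sesq_scale by (auto simp: gram_eq_def diag_fun_def d_def)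
  \<comment> \<open>The conjugate of an eigenvector belongs to the opposite eigenvalue, and - e_i
    differs from e_j, so the two are A-orthogonal. The computation plays the symmetry of A against
    the antisymmetry of J.\<close>
  have cross: "sesq ?m ?H (\<lambda>r. cnj (w (\<sigma> i) r)) (w (\<sigma> j)) = 0" if "i < n" "j < n" for i j
  proof -
    let ?\<alpha> = "\<lambda>i j. sesq ?m ?H (\<lambda>r. cnj (w (\<sigma> i) r)) (w (\<sigma> j))"
    let ?g = "\<lambda>i j. sesq ?m ?G (\<lambda>r. cnj (w (\<sigma> i) r)) (w (\<sigma> j))"
    have g: "?g i j = of_real (e (\<sigma> j)) * ?\<alpha> i j" "?g j i = of_real (e (\<sigma> i)) * ?\<alpha> j i"
      using eig \<sigma>S that by auto
    have "?\<alpha> i j = ?\<alpha> j i"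
      using cnj_sesq_cform[of ?m A "w (\<sigma> i)" "w (\<sigma> j)"]
        sesq_hermitian[OF herm, of "w (\<sigma> i)" "\<lambda>r. cnj (w (\<sigma> j) r)"] by simp
    moreover have "?g i j = - ?g j i"
      using cnj_sesq_symp_form[of ?m n "w (\<sigma> i)" "w (\<sigma> j)"]
        sesq_hermitian[OF hermitian_symp_form, of n "w (\<sigma> i)" "\<lambda>r. cnj (w (\<sigma> j) r)"] by simp
    ultimately have "of_real (e (\<sigma> i) + e (\<sigma> j)) * ?\<alpha> i j = 0"
      using g by (simp add: algebra_simps eq_neg_iff_add_eq_0)
    moreover have "complex_of_real (e (\<sigma> i) + e (\<sigma> j)) \<noteq> 0"
      using \<sigma>S(2)[OF that(1)] \<sigma>S(2)[OF that(2)] by (simp only: of_real_eq_0_iff)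
    ultimately show ?thesis by (simp only: mult_eq_0_iff simp_thms)
  qed
  have cnjx: "(\<lambda>r. cnj (x i r)) = (\<lambda>r. complex_of_real (sqrt (d i)) * cnj (w (\<sigma> i) r))" for i
    by (simp add: x_def)
  have crossH: "sesq ?m ?H (\<lambda>r. cnj (x i r)) (x j) = 0" if "i < n" "j < n" for i j
    unfolding cnjx unfolding x_def sesq_scale using cross[OF that] by simp
  have crossG: "sesq ?m ?G (\<lambda>r. cnj (x i r)) (x j) = 0" if "i < n" "j < n" for i j
    unfolding cnjx unfolding x_def sesq_scale using eig \<sigma>S that cross[OF that] by simp
  have crossH': "sesq ?m ?H (x i) (\<lambda>r. cnj (x j r)) = 0" if "i < n" "j < n" for i j
    using cnj_sesq_cform[of ?m A "x i" "x j"] crossH[OF that] by simp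
  have crossG': "sesq ?m ?G (x i) (\<lambda>r. cnj (x j r)) = 0" if "i < n" "j < n" for i j
    using cnj_sesq_symp_form[of ?m n "x i" "x j"] crossG[OF that] by simp
  have xH': "sesq ?m ?H (\<lambda>r. cnj (x i r)) (\<lambda>r. cnj (x j r)) = diag_fun d i j" if "i < n" "j < n" for i j
    unfolding cnj_sesq_cform using xH[OF that] by (simp add: diag_fun_def)
  have xG': "sesq ?m ?G (\<lambda>r. cnj (x i r)) (\<lambda>r. cnj (x j r)) = - diag_fun (\<lambda>_. 1) i j" if "i < n" "j < n" for i j
    unfolding cnj_sesq_symp_form using xG[OF that] by (simp add: diag_fun_def)
  have "sesq ?m ?G (Q i) (Q j) = diag_fun (frame_sign n) i j \<and>
      sesq ?m ?H (Q i) (Q j) = diag_fun (doubled n d) i j" if "i < ?m" "j < ?m" for i j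
    using that unfolding Q_def
    by (cases "i < n"; cases "j < n")
      (auto simp: xH xG xH' xG' crossH crossG crossH' crossG' diag_fun_def frame_sign_def doubled_def)
  then have "williamson_frame n A d Q"
    unfolding williamson_frame_def gram_eq_def by blast
  moreover have "Q (n + j) = (\<lambda>r. cnj (Q j r))" if "j < n" for j using that by (simp add: Q_def)
  ultimately obtain M where M: "symplectic n M" and
    D: "transpose_mat M * A * M = four_block_mat (mat_diag n d) (0\<^sub>m n n) (0\<^sub>m n n) (mat_diag n d)"
    using symplectic_of_frame[of n A d Q] A by blast
  have "mat_diag n (($) (vec n d)) = mat_diag n d" by (intro eq_matI) (auto simp: mat_diag_def)
  then have "williamson_form n A (vec n d)"
    unfolding williamson_form_def using dpos mono M D by (auto simp: d_def)
  then show ?thesis by blast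
qed

lemma williamson_form_frame:
  assumes "williamson_form n A d" and "A \<in> carrier_mat (2 * n) (2 * n)"
  obtains Q where "williamson_frame n A (($) d) Q"
  using assms frame_of_symplectic unfolding williamson_form_def by metis

section \<open>Comparison of symplectic eigenvalues\<close>

text \<open>The whole negative half of \<open>Q\<close> may join the columns from \<open>j\<close>
  on: there iJ is negative and A positive, so the lower bound demanded of A is trivial. This
  compensates for \<open>P\<close> having only \<open>n\<close> columns in dimension
  \<open>2 * n\<close>.\<close>

lemma symplectic_interlacing:
  assumes Q: "williamson_frame n A d Q" and d_pos: "\<And>i. i < n \<Longrightarrow> 0 < d i"
    and d_mono: "\<And>i j. i \<le> j \<Longrightarrow> j < n \<Longrightarrow> d i \<le> d j"
    and P: "gram_eq (2 * n) (symp_form n) n P (\<lambda>_. 1)"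
    and PA: "\<And>a. Re (sesq (2 * n) (cform A) (lincomb_fun n P a) (lincomb_fun n P a))
      \<le> (\<Sum>j<n. \<alpha> j * (cmod (a j))\<^sup>2)"
    and \<alpha>_mono: "\<And>i j. i \<le> j \<Longrightarrow> j < n \<Longrightarrow> \<alpha> i \<le> \<alpha> j"
    and j: "j < n"
  shows "d j \<le> \<alpha> j"
\<comment> \<open>The sizes j + 1 and 2n - j add up to 2n + 1, one more than the dimension.\<close>
proof (rule form_comparison[where S = "{..j}" and T = "{j..<2 * n}", OF _ _ _ P PA])
  show "gram_eq (2 * n) (symp_form n) (2 * n) Q (frame_sign n)"
    "gram_eq (2 * n) (cform A) (2 * n) Q (doubled n d)"
    using Q by (simp_all add: williamson_frame_def)
  fix i assume i: "i \<in> {j..<2 * n}"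
  show pos: "0 < doubled n d i" using i d_pos by (auto simp: doubled_def)
  show "d j * frame_sign n i \<le> doubled n d i"
  proof (cases "i < n")
    case True
    then show ?thesis using i d_mono by (simp add: frame_sign_def doubled_def)
  next
    case False
    then show ?thesis using pos d_pos[OF j] by (simp add: frame_sign_def)
  qed
qed (use j \<alpha>_mono in auto)

lemma positive_frame:
  assumes "williamson_frame n A d Q"
  shows "gram_eq (2 * n) (symp_form n) n Q (\<lambda>_. 1)" and "gram_eq (2 * n) (cform A) n Q d"
  using assms by (auto simp: williamson_frame_def gram_eq_def diag_fun_def frame_sign_def doubled_def)

text \<open>The positive half of either Williamson frame is a trial frame for the other, so the
  interlacing holds in both directions.\<close>

lemma williamson_unique:
  assumes A: "A \<in> carrier_mat (2 * n) (2 * n)" and d: "williamson_form n A d" and d': "williamson_form n A d'"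
  shows "d = d'"
proof -
  have le: "x $ j \<le> y $ j" if x: "williamson_form n A x" and y: "williamson_form n A y" and j: "j < n" for x y j
  proof -
    obtain Q where Q: "williamson_frame n A (($) x) Q" by (rule williamson_form_frame[OF x A])
    obtain P where P: "williamson_frame n A (($) y) P" by (rule williamson_form_frame[OF y A])
    show ?thesis
      by (rule symplectic_interlacing[OF Q _ _ positive_frame(1)[OF P] _ _ j])
        (use x y Re_sesq_gram[OF positive_frame(2)[OF P]] in \<open>auto simp: williamson_form_def\<close>)
  qed
  show ?thesis
  proof (rule eq_vecI)
    show "dim_vec d = dim_vec d'" using d d' by (auto simp: williamson_form_def)
    fix i assume "i < dim_vec d'"
    then have "i < n" using d' by (auto simp: williamson_form_def)
    then show "d $ i = d' $ i" using le[OF d d'] le[OF d' d] by (simp add: antisym)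
  qed
qed

lemma williamson_form_symplectic_eigenvalues:
  assumes "positive_definite (2 * n) A"
  shows "williamson_form n A (symplectic_eigenvalues n A)"
proof -
  obtain d where d: "williamson_form n A d" using williamson_exists[OF assms] by blast
  have "A \<in> carrier_mat (2 * n) (2 * n)" using assms by (simp add: positive_definite_def)
  from williamson_unique[OF this _ d] d show ?thesis
    unfolding symplectic_eigenvalues_def by (rule theI[where a = d, rotated])
qed

section \<open>The Lidskii inequality\<close>

text \<open>On the span of a positive eigenframe \<open>X\<close> of \<open>A + B\<close>, chosen such that \<open>B\<close> restricts to
  \<open>diag h\<close>, the matrix \<open>K\<close> below is the restriction of \<open>A + B\<close> minus \<open>diag (min h c)\<close>. It
  dominates the restriction of \<open>A\<close> and differs from that of \<open>A + B\<close> by at most \<open>c\<close>, while its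
  trace is explicit.\<close>

lemma symplectic_lidskii:
  assumes A: "positive_definite (2 * n) A" and B: "positive_definite (2 * n) B"
    and C: "positive_definite (2 * n) (A + B)"
    and I: "I \<subseteq> {..<n}" and k: "card I = k" "1 \<le> k"
  shows "(\<Sum>j<k. symplectic_eigenvalues n B $ j)
    \<le> (\<Sum>i\<in>I. symplectic_eigenvalues n (A + B) $ i - symplectic_eigenvalues n A $ i)"
proof -
  let ?m = "2 * n" and ?I = "diag_fun (\<lambda>_. 1)" and ?G = "symp_form n"
  define a b d where abd: "a = ($) (symplectic_eigenvalues n A)" "b = ($) (symplectic_eigenvalues n B)"
    "d = ($) (symplectic_eigenvalues n (A + B))"
  note carrier = A[unfolded positive_definite_def, THEN conjunct1]
    B[unfolded positive_definite_def, THEN conjunct1] C[unfolded positive_definite_def, THEN conjunct1]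
  note wf = williamson_form_symplectic_eigenvalues[OF A] williamson_form_symplectic_eigenvalues[OF B]
    williamson_form_symplectic_eigenvalues[OF C]
  obtain QA where QA: "williamson_frame n A a QA"
    using williamson_form_frame[OF wf(1) carrier(1)] abd by metis
  obtain QB where QB: "williamson_frame n B b QB"
    using williamson_form_frame[OF wf(2) carrier(2)] abd by metis
  obtain Q where Q: "williamson_frame n (A + B) d Q"
    using williamson_form_frame[OF wf(3) carrier(3)] abd by metis
  have pos: "0 < a i" "0 < b i" "0 < d i" if "i < n" for i
    using wf that by (auto simp: williamson_form_def abd)
  have mono: "a i \<le> a j" "b i \<le> b j" "d i \<le> d j" if "i \<le> j" "j < n" for i j
    using wf that by (auto simp: williamson_form_def abd)
  have hermB: "hermitian_fun ?m (cform B)" and hermC: "hermitian_fun ?m (cform (A + B))"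
    using positive_definite_pos_form B C by (auto simp: pos_form_def)
  have cform_add: "sesq ?m (cform (A + B)) x y = sesq ?m (cform A) x y + sesq ?m (cform B) x y" for x y
    unfolding sesq_add_form[symmetric] using carrier by (intro sesq_cong) (auto simp: cform_def)
  have kn: "k \<le> n" using card_mono[OF _ I] k by simp
  \<comment> \<open>A unitary change of the first \<open>n\<close> vectors of \<open>Q\<close> keeps
    iJ equal to the identity on them, so B can be diagonalised there freely.\<close>
  obtain V h where V: "gram_eq n ?I n V (\<lambda>_. 1)"
    and VB: "gram_eq n (\<lambda>i j. sesq ?m (cform B) (Q i) (Q j)) n V h"
    and h_mono: "\<And>i j. i \<le> j \<Longrightarrow> j < n \<Longrightarrow> h i \<le> h j"
    using hermitian_diagonalisation_sorted[OF hermitian_fun_gram[OF hermB], of n Q] by metis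
  define X where "X i = lincomb_fun n Q (V i)" for i
  have XG: "gram_eq ?m ?G n X (\<lambda>_. 1)"
    unfolding X_def by (rule gram_eq_lincomb_diag[OF positive_frame(1)[OF Q] V])
  have XB: "gram_eq ?m (cform B) n X h"
    unfolding X_def by (rule gram_eq_lincomb[OF refl VB])
  have bh: "b j \<le> h j" if "j < n" for j
    by (rule symplectic_interlacing[OF QB _ _ XG _ _ that])
      (simp_all add: Re_sesq_gram[OF XB] pos mono h_mono)
  \<comment> \<open>The cut-off is the \<open>k\<close>-th smallest eigenvalue of the restriction of
    B; indices start at \<open>0\<close>.\<close>
  define c where "c = h (k - 1)"
  \<comment> \<open>The truncation serves three ends: \<open>g \<le> h\<close> controls A,
    \<open>g \<le> c\<close> controls A + B, and \<open>c - g\<close> vanishes from index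
    \<open>k\<close> on.\<close>
  define g where "g i = min (h i) c" for i
  define E where "E i j = sesq ?m (cform (A + B)) (X i) (X j)" for i j
  define K where "K i j = E i j + diag_fun (\<lambda>i. - g i) i j" for i j
  have hermK: "hermitian_fun n K"
    unfolding hermitian_fun_def
  proof (intro allI impI)
    fix r s
    have "E s r = cnj (E r s)" unfolding E_def by (rule sesq_hermitian[OF hermC])
    then show "K s r = cnj (K r s)" by (simp add: K_def diag_fun_def)
  qed
  obtain U e where U: "gram_eq n ?I n U (\<lambda>_. 1)" and UK: "gram_eq n K n U e"
    and e_mono: "\<And>i j. i \<le> j \<Longrightarrow> j < n \<Longrightarrow> e i \<le> e j"
    using hermitian_diagonalisation_sorted[OF hermK] by metis
  define Y where "Y i = lincomb_fun n X (U i)" for i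
  have YG: "gram_eq ?m ?G n Y (\<lambda>_. 1)"
    unfolding Y_def by (rule gram_eq_lincomb_diag[OF XG U])
  have UI: "(\<Sum>i<n. (cmod (lincomb_fun n U t i))\<^sup>2) = (\<Sum>i<n. (cmod (t i))\<^sup>2)" for t
    using Re_sesq_gram[OF U, of t] by (simp add: Re_sesq_diag_fun)
  have YC: "Re (sesq ?m (cform (A + B)) (lincomb_fun n Y t) (lincomb_fun n Y t)) =
      (\<Sum>i<n. e i * (cmod (t i))\<^sup>2) + (\<Sum>i<n. g i * (cmod (lincomb_fun n U t i))\<^sup>2)" for t
  proof -
    let ?u = "lincomb_fun n U t"
    have "sesq n K ?u ?u = sesq n E ?u ?u + sesq n (diag_fun (\<lambda>i. - g i)) ?u ?u"
      unfolding K_def sesq_add_form ..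
    then have "Re (sesq n E ?u ?u) = Re (sesq n K ?u ?u) + (\<Sum>i<n. g i * (cmod (?u i))\<^sup>2)"
      by (simp add: Re_sesq_diag_fun sum_negf)
    moreover have "sesq ?m (cform (A + B)) (lincomb_fun n Y t) (lincomb_fun n Y t) = sesq n E ?u ?u"
      unfolding Y_def lincomb_fun_assoc sesq_lincomb E_def ..
    ultimately show ?thesis using Re_sesq_gram[OF UK, of t] by simp
  qed
  have YB: "Re (sesq ?m (cform B) (lincomb_fun n Y t) (lincomb_fun n Y t)) =
      (\<Sum>i<n. h i * (cmod (lincomb_fun n U t i))\<^sup>2)" for t
    unfolding Y_def lincomb_fun_assoc by (rule Re_sesq_gram[OF XB])
  have ae: "a j \<le> e j" if "j < n" for j
  proof (rule symplectic_interlacing[OF QA _ _ YG _ _ that])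
    fix t
    have "(\<Sum>i<n. g i * (cmod (lincomb_fun n U t i))\<^sup>2) \<le> (\<Sum>i<n. h i * (cmod (lincomb_fun n U t i))\<^sup>2)"
      by (intro sum_mono mult_right_mono) (auto simp: g_def)
    then show "Re (sesq ?m (cform A) (lincomb_fun n Y t) (lincomb_fun n Y t)) \<le> (\<Sum>i<n. e i * (cmod (t i))\<^sup>2)"
      using YC[of t] YB[of t] by (simp add: cform_add)
  qed (use pos mono e_mono in auto)
  \<comment> \<open>The interlacing acts as Weyl's inequality: \<open>Y\<close> is a unitary
    recombination of \<open>X\<close>, and on it A + B is at most diag e + c.\<close>
  have de: "d j \<le> e j + c" if "j < n" for j
  proof (rule symplectic_interlacing[OF Q _ _ YG _ _ that])
    fix t
    have "(\<Sum>i<n. g i * (cmod (lincomb_fun n U t i))\<^sup>2) \<le> c * (\<Sum>i<n. (cmod (lincomb_fun n U t i))\<^sup>2)"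
      unfolding sum_distrib_left by (intro sum_mono mult_right_mono) (auto simp: g_def)
    then show "Re (sesq ?m (cform (A + B)) (lincomb_fun n Y t) (lincomb_fun n Y t))
        \<le> (\<Sum>i<n. (e i + c) * (cmod (t i))\<^sup>2)"
      using YC[of t] UI[of t] by (simp add: ring_distribs sum.distrib sum_distrib_left)
  qed (use pos mono e_mono in auto)
  \<comment> \<open>\<open>K\<close> has trace sum e by the basis \<open>U\<close>; the compression
    of A + B is unitarily similar to diag d through \<open>V\<close>.\<close>
  have "(\<Sum>i<n. complex_of_real (e i)) = (\<Sum>i<n. sesq n K (U i) (U i))"
    using UK by (simp add: gram_eq_def diag_fun_def)
  also have "\<dots> = (\<Sum>i<n. K i i)" by (rule trace_orthonormal[OF U])
  also have "\<dots> = (\<Sum>i<n. E i i) - (\<Sum>i<n. complex_of_real (g i))"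
    by (simp add: K_def diag_fun_def sum_subtractf)
  also have "(\<Sum>i<n. E i i) = (\<Sum>i<n. sesq n (diag_fun d) (V i) (V i))"
    unfolding E_def X_def sesq_gram[OF positive_frame(2)[OF Q]] ..
  also have "\<dots> = (\<Sum>i<n. complex_of_real (d i))"
    unfolding trace_orthonormal[OF V] by (simp add: diag_fun_def)
  finally have "complex_of_real (\<Sum>i<n. e i) = of_real ((\<Sum>i<n. d i) - (\<Sum>i<n. g i))" by simp
  then have trace: "(\<Sum>i<n. e i) = (\<Sum>i<n. d i) - (\<Sum>i<n. g i)" by (simp only: of_real_eq_iff)
  \<comment> \<open>By \<open>de\<close> all terms are nonnegative, so passing from \<open>I\<close>
    to all indices only increases the sum, and the full sum is fixed by the trace.\<close>
  have "(\<Sum>i\<in>I. c - (d i - e i)) \<le> (\<Sum>i<n. c - (d i - e i))"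
    using I de by (intro sum_mono2) (auto simp: algebra_simps)
  also have "\<dots> = (\<Sum>i<n. c - g i)"
    using trace by (simp add: sum_subtractf)
  also have "\<dots> = (\<Sum>i<k. c - h i)"
  proof (rule sum.mono_neutral_cong_right)
    show "\<forall>i\<in>{..<n} - {..<k}. c - g i = 0"
    proof
      fix i assume "i \<in> {..<n} - {..<k}"
      then have "c \<le> h i" unfolding c_def by (intro h_mono) auto
      then show "c - g i = 0" by (simp add: g_def)
    qed
    fix i assume "i \<in> {..<k}"
    then have "h i \<le> c" unfolding c_def using k(2) kn by (intro h_mono) auto
    then show "c - g i = c - h i" by (simp add: g_def)
  qed (use kn in auto)
  finally have "(\<Sum>i\<in>I. c - (d i - e i)) \<le> (\<Sum>i<k. c - h i)" .
  \<comment> \<open>Both sides contain \<open>c\<close> exactly \<open>k\<close> times, since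
    \<open>card I = k\<close>.\<close>
  then have "(\<Sum>i<k. h i) \<le> (\<Sum>i\<in>I. d i - e i)"
    unfolding sum_subtractf[of "\<lambda>_. c"] using k(1) by simp
  also have "\<dots> \<le> (\<Sum>i\<in>I. d i - a i)"
    using I ae by (intro sum_mono) auto
  finally have "(\<Sum>i<k. h i) \<le> (\<Sum>i\<in>I. d i - a i)" .
  moreover have "(\<Sum>i<k. b i) \<le> (\<Sum>i<k. h i)"
    using bh kn by (intro sum_mono) auto
  ultimately show ?thesis by (simp add: abd)
qed

section \<open>From index sets to supermajorisation\<close>

lemma sum_increasing_rearrangement:
  assumes x: "x \<in> carrier_vec n" and k: "k \<le> n"
  obtains I where "I \<subseteq> {..<n}" "card I = k"
    "(\<Sum>j<k. increasing_rearrangement x $ j) = (\<Sum>i\<in>I. x $ i)"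
proof -
  let ?xs = "list_of_vec x"
  have len: "length ?xs = n" using x by simp
  obtain f where f: "f permutes {..<length ?xs}" "permute_list f ?xs = sort ?xs"
    using mset_eq_permutation[of "sort ?xs" ?xs] by auto
  have nth: "increasing_rearrangement x $ j = x $ f j" if "j < n" for j
  proof -
    have "f j < n" using permutes_in_image[OF f(1), of j] that len by simp
    then show ?thesis using permute_list_nth[OF f(1), of j] that f(2) len x
      by (simp add: increasing_rearrangement_def list_of_vec_index vec_of_list_index)
  qed
  have inj: "inj_on f {..<k}" by (rule permutes_inj_on[OF f(1)])
  show thesis
  proof (rule that[of "f ` {..<k}"])
    show "f ` {..<k} \<subseteq> {..<n}"
    proof
      fix i assume "i \<in> f ` {..<k}"
      then obtain j where "j < k" "i = f j" by blast
      then show "i \<in> {..<n}" using permutes_in_image[OF f(1), of j] len k by simp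
    qed
    show "card (f ` {..<k}) = k" using inj by (simp add: card_image)
    show "(\<Sum>j<k. increasing_rearrangement x $ j) = (\<Sum>i\<in>f ` {..<k}. x $ i)"
      unfolding sum.reindex[OF inj] o_def using nth k by (intro sum.cong) auto
  qed
qed

lemma increasing_rearrangement_id:
  assumes x: "x \<in> carrier_vec n" and "\<And>i j. i \<le> j \<Longrightarrow> j < n \<Longrightarrow> x $ i \<le> x $ j"
  shows "increasing_rearrangement x = x"
proof -
  have "sorted (list_of_vec x)"
    using assms by (auto simp: sorted_iff_nth_mono list_of_vec_index)
  then show ?thesis by (simp add: increasing_rearrangement_def sorted_sort_id vec_list)
qed

lemma positive_definite_add:
  assumes "positive_definite m A" "positive_definite m B"
  shows "positive_definite m (A + B)"
proof -
  have A: "A \<in> carrier_mat m m" and B: "B \<in> carrier_mat m m"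
    using assms by (auto simp: positive_definite_def)
  have "v \<bullet> ((A + B) *\<^sub>v v) = v \<bullet> (A *\<^sub>v v) + v \<bullet> (B *\<^sub>v v)" if "v \<in> carrier_vec m" for v
    using A B that by (simp add: add_mult_distrib_mat_vec scalar_prod_add_distrib[of _ m])
  then show ?thesis
    using assms A B by (auto simp: positive_definite_def transpose_add add_pos_pos)
qed

theorem theorem5p5:
  fixes n :: nat and A B :: "real mat"
  assumes "positive_definite (2 * n) A" and "positive_definite (2 * n) B"
  shows "supermajorised n
           (symplectic_eigenvalues n (A + B) - symplectic_eigenvalues n A)
           (symplectic_eigenvalues n B)"
proof -
  let ?d = "symplectic_eigenvalues n"
  note C = positive_definite_add[OF assms]
  note wf = williamson_form_symplectic_eigenvalues
  have carrier: "?d A \<in> carrier_vec n" "?d B \<in> carrier_vec n" "?d (A + B) \<in> carrier_vec n"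
    using wf[OF assms(1)] wf[OF assms(2)] wf[OF C] by (auto simp: williamson_form_def)
  have sorted: "increasing_rearrangement (?d B) = ?d B"
    using wf[OF assms(2)] by (intro increasing_rearrangement_id) (auto simp: williamson_form_def)
  show ?thesis
    unfolding supermajorised_def sorted
  proof (intro conjI ballI)
    fix k assume k: "k \<in> {1..n}"
    \<comment> \<open>The difference of the two ordered vectors need not be increasing: its
      \<open>k\<close> smallest entries can sit anywhere, which is why the inequality is needed for
      arbitrary index sets.\<close>
    obtain I where I: "I \<subseteq> {..<n}" "card I = k"
      and sum: "(\<Sum>j<k. increasing_rearrangement (?d (A + B) - ?d A) $ j) = (\<Sum>i\<in>I. (?d (A + B) - ?d A) $ i)"
      using sum_increasing_rearrangement[of "?d (A + B) - ?d A" n k] carrier k by auto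
    have "(\<Sum>i\<in>I. (?d (A + B) - ?d A) $ i) = (\<Sum>i\<in>I. ?d (A + B) $ i - ?d A $ i)"
      using I carrier by (intro sum.cong) auto
    then show "(\<Sum>j<k. ?d B $ j) \<le> (\<Sum>j<k. increasing_rearrangement (?d (A + B) - ?d A) $ j)"
      using symplectic_lidskii[OF assms C I] k sum by simp
  qed (use carrier in auto)
qed

end
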